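(* Let $n\ge 1$, let $U\subset S^n$ be a (closed) ring neighborhood of the equator $S^{n-1}\subset S^n$, and let $f:(S^n,U)\to(S^n,U)$ be a continuous map of pairs without periodic points in $\overline{S^n\setminus U}$. Let $$\begin{pmatrix} a&b\\ c&d\end{pmatrix}$$ be the matrix (with respect to a basis) of the linear map induced by $f$ on $H_n(S^n,U;\mathbb{Q})\cong\mathbb{Q}\oplus\mathbb{Q}$. Then $a=-d$ and $bc=-a^2$.
   Context: A ring neighborhood of the equator is a neighborhood $U$ of $S^{n-1}$ in $S^n$ that is a subcomplex of some triangulation of $S^n$ and is homeomorphic to $S^{n-1}\times[-1,1]$ with the equator corresponding to $S^{n-1}\times\{0\}$ (e.g. $U=\{x\in S^n\subset\mathbb{R}^{n+1}: |x_{n+1}|\le\varepsilon\}$ with $0<\varepsilon<1$). The relative groups $H_k(S^n,U;\mathbb{Q})$ vanish except for $H_n(S^n,U;\mathbb{Q})=\mathbb{Q}\oplus\mathbb{Q}$. A periodic point of $f$ is a point $x$ with $f^m(x)=x$ for some integer $m\ge 1$; the hypothesis is that no such $x$ lies in $\overline{S^n\setminus U}$ (the closure of $S^n\setminus U$). *)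

theory Defs
  imports "HOL-Homology.Homology" "HOL-Analysis.Analysis"
begin

section \<open>Singular chains with rational coefficients\<close>

text \<open>
  The distribution develops singular homology with integer coefficients only. The definitions below
  follow theories \<open>Simplices\<close> and \<open>Homology_Groups\<close> with \<open>int\<close> replaced by \<open>rat\<close>;
  singular simplices, their faces and their images under maps are the library's.
\<close>

type_synonym 'a rat_chain = "((nat \<Rightarrow> real) \<Rightarrow> 'a) \<Rightarrow>\<^sub>0 rat"

definition rat_cmul :: "rat \<Rightarrow> ('b \<Rightarrow>\<^sub>0 rat) \<Rightarrow> ('b \<Rightarrow>\<^sub>0 rat)"
  where "rat_cmul q c = Poly_Mapping.map ((*) q) c"

definition rat_extend :: "('b \<Rightarrow> ('c \<Rightarrow>\<^sub>0 rat)) \<Rightarrow> ('b \<Rightarrow>\<^sub>0 rat) \<Rightarrow> ('c \<Rightarrow>\<^sub>0 rat)"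
  where "rat_extend b c = (\<Sum>i\<in>Poly_Mapping.keys c. rat_cmul (Poly_Mapping.lookup c i) (b i))"

definition rat_singular_chain :: "nat \<Rightarrow> 'a topology \<Rightarrow> 'a rat_chain \<Rightarrow> bool"
  where "rat_singular_chain p X c \<longleftrightarrow> Poly_Mapping.keys c \<subseteq> singular_simplex_set p X"

definition rat_chain_boundary :: "nat \<Rightarrow> 'a rat_chain \<Rightarrow> 'a rat_chain"
  where "rat_chain_boundary p c =
    (if p = 0 then 0
     else rat_extend (\<lambda>s. \<Sum>k\<le>p. Poly_Mapping.single (singular_face p k s) ((-1) ^ k)) c)"

definition rat_chain_map :: "nat \<Rightarrow> ('a \<Rightarrow> 'b) \<Rightarrow> 'a rat_chain \<Rightarrow> 'b rat_chain"
  where "rat_chain_map p g c = rat_extend (\<lambda>s. Poly_Mapping.single (simplex_map p g s) 1) c"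

definition rat_relcycle :: "nat \<Rightarrow> 'a topology \<Rightarrow> 'a set \<Rightarrow> 'a rat_chain \<Rightarrow> bool"
  where "rat_relcycle p X S c \<longleftrightarrow>
    rat_singular_chain p X c \<and>
    rat_singular_chain (p - 1) (subtopology X S) (rat_chain_boundary p c)"

definition rat_relboundary :: "nat \<Rightarrow> 'a topology \<Rightarrow> 'a set \<Rightarrow> 'a rat_chain \<Rightarrow> bool"
  where "rat_relboundary p X S c \<longleftrightarrow>
    (\<exists>d. rat_singular_chain (Suc p) X d \<and>
         rat_singular_chain p (subtopology X S) (rat_chain_boundary (Suc p) d - c))"


section \<open>The rational vector space \<open>H\<^sub>p(X,S;\<rat>)\<close> and induced maps\<close>

definition rat_homology_class :: "nat \<Rightarrow> 'a topology \<Rightarrow> 'a set \<Rightarrow> 'a rat_chain \<Rightarrow> 'a rat_chain set"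
  where "rat_homology_class p X S c = {c'. rat_relboundary p X S (c - c')}"

definition rat_field :: "rat ring"
  where "rat_field = \<lparr>carrier = UNIV, monoid.mult = (*), one = 1, zero = 0, add = (+)\<rparr>"

text \<open>
  The record type \<open>module\<close> extends \<open>ring\<close>; the fields \<open>mult\<close> and \<open>one\<close> play no role
  in the locale \<open>module\<close> and are left unspecified. A union over representatives of their
  classes is the class of any one of them.
\<close>

definition rat_homology :: "nat \<Rightarrow> 'a topology \<Rightarrow> 'a set \<Rightarrow> (rat, 'a rat_chain set) module"
  where "rat_homology p X S =
    \<lparr>carrier = rat_homology_class p X S ` Collect (rat_relcycle p X S),
     monoid.mult = undefined, one = undefined,
     zero = rat_homology_class p X S 0,
     add = (\<lambda>A B. \<Union>a\<in>A. \<Union>b\<in>B. rat_homology_class p X S (a + b)),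
     module.smult = (\<lambda>q A. \<Union>a\<in>A. rat_homology_class p X S (rat_cmul q a))\<rparr>"

definition rat_hom_induced ::
    "nat \<Rightarrow> 'a topology \<Rightarrow> 'a set \<Rightarrow> 'b topology \<Rightarrow> 'b set \<Rightarrow> ('a \<Rightarrow> 'b) \<Rightarrow>
     'a rat_chain set \<Rightarrow> 'b rat_chain set"
  where "rat_hom_induced p X S Y T f A =
    (\<Union>a\<in>A. rat_homology_class p Y T (rat_chain_map p f a))"

definition basis_pair :: "('r, 'm) module \<Rightarrow> 'r ring \<Rightarrow> 'm \<Rightarrow> 'm \<Rightarrow> bool"
  where "basis_pair M R u v \<longleftrightarrow>
    u \<in> carrier M \<and> v \<in> carrier M \<and>
    (\<forall>p\<in>carrier R. \<forall>q\<in>carrier R.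
       p \<odot>\<^bsub>M\<^esub> u \<oplus>\<^bsub>M\<^esub> q \<odot>\<^bsub>M\<^esub> v = \<zero>\<^bsub>M\<^esub> \<longrightarrow> p = \<zero>\<^bsub>R\<^esub> \<and> q = \<zero>\<^bsub>R\<^esub>) \<and>
    (\<forall>x\<in>carrier M. \<exists>p\<in>carrier R. \<exists>q\<in>carrier R. x = p \<odot>\<^bsub>M\<^esub> u \<oplus>\<^bsub>M\<^esub> q \<odot>\<^bsub>M\<^esub> v)"


section \<open>The operations on homology classes are well defined\<close>

lemma lookup_rat_cmul [simp]: "Poly_Mapping.lookup (rat_cmul q c) k = q * Poly_Mapping.lookup c k"
  by (simp add: rat_cmul_def Poly_Mapping.map.rep_eq when_def)

lemma rat_cmul_simps:
  "rat_cmul q (c + d) = rat_cmul q c + rat_cmul q d"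
  "rat_cmul q (c - d) = rat_cmul q c - rat_cmul q d"
  "rat_cmul (q + r) c = rat_cmul q c + rat_cmul r c"
  "rat_cmul (q * r) c = rat_cmul q (rat_cmul r c)"
  "rat_cmul 1 c = c" "rat_cmul 0 c = 0" "rat_cmul q 0 = 0" "rat_cmul (-1) c = - c"
  by (rule poly_mapping_eqI; simp add: lookup_add lookup_minus algebra_simps)+

lemma rat_cmul_single [simp]: "rat_cmul q (Poly_Mapping.single k r) = Poly_Mapping.single k (q * r)"
  by (rule poly_mapping_eqI) (simp add: lookup_single when_def)

lemma rat_cmul_sum: "rat_cmul q (sum f A) = (\<Sum>i\<in>A. rat_cmul q (f i))"
  by (induction A rule: infinite_finite_induct) (auto simp: rat_cmul_simps)

lemma keys_rat_cmul: "Poly_Mapping.keys (rat_cmul q c) \<subseteq> Poly_Mapping.keys c"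
  by (auto simp: in_keys_iff)

lemma rat_extend_superset:
  assumes "finite A" "Poly_Mapping.keys c \<subseteq> A"
  shows "rat_extend b c = (\<Sum>i\<in>A. rat_cmul (Poly_Mapping.lookup c i) (b i))"
  unfolding rat_extend_def
  by (rule sum.mono_neutral_left) (use assms in \<open>auto simp: in_keys_iff rat_cmul_simps\<close>)

lemma rat_extend_add: "rat_extend b (c + d) = rat_extend b c + rat_extend b d"
proof -
  let ?A = "Poly_Mapping.keys c \<union> Poly_Mapping.keys d"
  have "Poly_Mapping.keys (c + d) \<subseteq> ?A"
    by (rule Poly_Mapping.keys_add)
  then show ?thesis
    by (simp add: rat_extend_superset [of ?A] lookup_add rat_cmul_simps sum.distrib)
qed

lemma rat_extend_cmul: "rat_extend b (rat_cmul q c) = rat_cmul q (rat_extend b c)"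
  using keys_rat_cmul [of q c]
  by (simp add: rat_extend_superset [of "Poly_Mapping.keys c"] rat_cmul_sum rat_cmul_simps)

lemma rat_extend_0 [simp]: "rat_extend b 0 = 0"
  by (simp add: rat_extend_def)

lemma rat_extend_single [simp]: "rat_extend b (Poly_Mapping.single k q) = rat_cmul q (b k)"
  by (simp add: rat_extend_superset [of "{k}"] )

lemma rat_extend_diff: "rat_extend b (c - d) = rat_extend b c - rat_extend b d"
  using rat_extend_add [of b c "- d"] rat_extend_cmul [of b "-1" d] by (simp add: rat_cmul_simps)

lemma rat_extend_sum: "rat_extend b (sum f A) = (\<Sum>i\<in>A. rat_extend b (f i))"
  by (induction A rule: infinite_finite_induct) (auto simp: rat_extend_add)

lemma rat_singular_chain_simps:
  "rat_singular_chain p X 0"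
  "rat_singular_chain p X c \<Longrightarrow> rat_singular_chain p X d \<Longrightarrow> rat_singular_chain p X (c + d)"
  "rat_singular_chain p X c \<Longrightarrow> rat_singular_chain p X (rat_cmul q c)"
  using Poly_Mapping.keys_add [of c d] keys_rat_cmul [of q c]
  by (auto simp: rat_singular_chain_def)

lemma rat_singular_chain_sum:
  "(\<And>i. i \<in> A \<Longrightarrow> rat_singular_chain p X (f i)) \<Longrightarrow> rat_singular_chain p X (sum f A)"
  by (induction A rule: infinite_finite_induct) (auto simp: rat_singular_chain_simps)

lemma rat_singular_chain_map:
  assumes "rat_singular_chain p X c" "continuous_map X Y f"
  shows "rat_singular_chain p Y (rat_chain_map p f c)"
  unfolding rat_chain_map_def rat_extend_def
  using assms
  by (intro rat_singular_chain_sum)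
     (auto simp: rat_singular_chain_def intro!: singular_simplex_simplex_map)

lemma rat_chain_boundary_linear:
  "rat_chain_boundary p (c + d) = rat_chain_boundary p c + rat_chain_boundary p d"
  "rat_chain_boundary p (rat_cmul q c) = rat_cmul q (rat_chain_boundary p c)"
  "rat_chain_boundary p 0 = 0"
  by (auto simp: rat_chain_boundary_def rat_extend_add rat_extend_cmul rat_cmul_simps)

lemma rat_chain_map_linear:
  "rat_chain_map p f (c + d) = rat_chain_map p f c + rat_chain_map p f d"
  "rat_chain_map p f (c - d) = rat_chain_map p f c - rat_chain_map p f d"
  "rat_chain_map p f (rat_cmul q c) = rat_cmul q (rat_chain_map p f c)"
  by (auto simp: rat_chain_map_def rat_extend_add rat_extend_diff rat_extend_cmul)

lemma rat_chain_boundary_chain_map: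
  "rat_chain_boundary p (rat_chain_map p f c) = rat_chain_map (p - 1) f (rat_chain_boundary p c)"
proof (cases "p = 0")
  case True
  then show ?thesis by (simp add: rat_chain_boundary_def rat_chain_map_def)
next
  case False
  let ?B = "\<lambda>s. \<Sum>k\<le>p. Poly_Mapping.single (singular_face p k s) ((-1) ^ k)"
  let ?M = "\<lambda>q s. Poly_Mapping.single (simplex_map q f s) (1 :: rat)"
  have face: "singular_face p k (simplex_map p f s) = simplex_map (p - 1) f (singular_face p k s)"
    if "k \<le> p" for k s
    using that False
    by (fastforce simp: singular_face_def simplex_map_def simplical_face_in_standard_simplex)
  have "rat_extend ?B (?M p s) = rat_extend (?M (p - 1)) (?B s)" for s
  proof -
    have "rat_extend ?B (?M p s) = ?B (simplex_map p f s)"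
      by (simp add: rat_cmul_simps)
    also have "\<dots> = (\<Sum>k\<le>p. rat_cmul ((-1) ^ k) (?M (p - 1) (singular_face p k s)))"
      by (rule sum.cong) (simp_all add: face)
    also have "\<dots> = rat_extend (?M (p - 1)) (?B s)"
      by (simp only: rat_extend_sum rat_extend_single)
    finally show ?thesis .
  qed
  then have "rat_extend ?B (rat_extend (?M p) c) = rat_extend (?M (p - 1)) (rat_extend ?B c)"
    by (simp only: rat_extend_def [where c = c] rat_extend_sum rat_extend_cmul)
  then show ?thesis
    using False by (simp only: rat_chain_boundary_def rat_chain_map_def if_False)
qed

lemma rat_relboundary_simps:
  "rat_relboundary p X S 0"
  "rat_relboundary p X S c \<Longrightarrow> rat_relboundary p X S d \<Longrightarrow> rat_relboundary p X S (c + d)"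
  "rat_relboundary p X S c \<Longrightarrow> rat_relboundary p X S (rat_cmul q c)"
proof -
  show "rat_relboundary p X S 0"
    unfolding rat_relboundary_def
    by (rule exI [of _ 0]) (simp add: rat_singular_chain_simps rat_chain_boundary_linear)
  show "rat_relboundary p X S (c + d)" if c: "rat_relboundary p X S c" and d: "rat_relboundary p X S d"
  proof -
    obtain c' d' where cd:
      "rat_singular_chain (Suc p) X c'"
      "rat_singular_chain p (subtopology X S) (rat_chain_boundary (Suc p) c' - c)"
      "rat_singular_chain (Suc p) X d'"
      "rat_singular_chain p (subtopology X S) (rat_chain_boundary (Suc p) d' - d)"
      using c d by (auto simp: rat_relboundary_def)
    have "rat_chain_boundary (Suc p) (c' + d') - (c + d)
        = (rat_chain_boundary (Suc p) c' - c) + (rat_chain_boundary (Suc p) d' - d)"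
      by (simp add: rat_chain_boundary_linear)
    with cd show ?thesis
      unfolding rat_relboundary_def by (metis rat_singular_chain_simps(2))
  qed
  show "rat_relboundary p X S (rat_cmul q c)" if "rat_relboundary p X S c"
    using that unfolding rat_relboundary_def
    by (metis rat_chain_boundary_linear(2) rat_cmul_simps(2) rat_singular_chain_simps(3))
qed

lemma rat_relcycle_simps:
  "rat_relcycle p X S 0"
  "rat_relcycle p X S c \<Longrightarrow> rat_relcycle p X S d \<Longrightarrow> rat_relcycle p X S (c + d)"
  "rat_relcycle p X S c \<Longrightarrow> rat_relcycle p X S (rat_cmul q c)"
  by (auto simp: rat_relcycle_def rat_chain_boundary_linear rat_singular_chain_simps)

lemma rat_homology_class_eq_iff:
  "rat_homology_class p X S c = rat_homology_class p X S d \<longleftrightarrow> rat_relboundary p X S (c - d)"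
proof
  assume "rat_homology_class p X S c = rat_homology_class p X S d"
  moreover have "d \<in> rat_homology_class p X S d"
    by (simp add: rat_homology_class_def rat_relboundary_simps)
  ultimately show "rat_relboundary p X S (c - d)"
    by (auto simp: rat_homology_class_def)
next
  assume cd: "rat_relboundary p X S (c - d)"
  then have dc: "rat_relboundary p X S (d - c)"
    using rat_relboundary_simps(3) [of p X S "c - d" "-1"] by (simp add: rat_cmul_simps)
  show "rat_homology_class p X S c = rat_homology_class p X S d"
    using rat_relboundary_simps(2) [OF cd] rat_relboundary_simps(2) [OF dc]
    by (fastforce simp: rat_homology_class_def)
qed

lemma mem_rat_homology_class:
  "c' \<in> rat_homology_class p X S c \<longleftrightarrow> rat_homology_class p X S c' = rat_homology_class p X S c"
  by (metis mem_Collect_eq rat_homology_class_def rat_homology_class_eq_iff)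

lemma rat_homology_add:
  "rat_homology_class p X S c \<oplus>\<^bsub>rat_homology p X S\<^esub> rat_homology_class p X S d
     = rat_homology_class p X S (c + d)"
proof -
  have "rat_homology_class p X S (a + b) = rat_homology_class p X S (c + d)"
    if "a \<in> rat_homology_class p X S c" "b \<in> rat_homology_class p X S d" for a b
    using that rat_relboundary_simps(2) [of p X S "a - c" "b - d"]
    by (simp add: mem_rat_homology_class rat_homology_class_eq_iff algebra_simps)
  moreover have "c \<in> rat_homology_class p X S c" "d \<in> rat_homology_class p X S d"
    by (simp_all add: mem_rat_homology_class)
  ultimately have "(\<Union>a\<in>rat_homology_class p X S c. \<Union>b\<in>rat_homology_class p X S d.
      rat_homology_class p X S (a + b)) = rat_homology_class p X S (c + d)"
    by blast
  then show ?thesis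
    by (simp add: rat_homology_def)
qed

lemma rat_homology_smult:
  "q \<odot>\<^bsub>rat_homology p X S\<^esub> rat_homology_class p X S c = rat_homology_class p X S (rat_cmul q c)"
proof -
  have "rat_homology_class p X S (rat_cmul q a) = rat_homology_class p X S (rat_cmul q c)"
    if "a \<in> rat_homology_class p X S c" for a
    using that rat_relboundary_simps(3) [of p X S "a - c" q]
    by (simp add: mem_rat_homology_class rat_homology_class_eq_iff rat_cmul_simps)
  moreover have "c \<in> rat_homology_class p X S c"
    by (simp add: mem_rat_homology_class)
  ultimately have "(\<Union>a\<in>rat_homology_class p X S c. rat_homology_class p X S (rat_cmul q a))
      = rat_homology_class p X S (rat_cmul q c)"
    by blast
  then show ?thesis
    by (simp add: rat_homology_def)
qed

lemma cring_rat_field: "cring rat_field"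
proof (rule cringI)
  show "abelian_group rat_field"
  proof (rule abelian_groupI)
    show "\<exists>y\<in>carrier rat_field. y \<oplus>\<^bsub>rat_field\<^esub> x = \<zero>\<^bsub>rat_field\<^esub>" for x
      by (rule bexI [of _ "- x"]) (simp_all add: rat_field_def)
  qed (simp_all add: rat_field_def)
  show "comm_monoid rat_field"
    by (rule comm_monoidI) (simp_all add: rat_field_def)
qed (simp add: rat_field_def algebra_simps)

lemma carrier_rat_homology:
  "carrier (rat_homology p X S) = rat_homology_class p X S ` Collect (rat_relcycle p X S)"
  by (simp add: rat_homology_def)

lemma zero_rat_homology: "\<zero>\<^bsub>rat_homology p X S\<^esub> = rat_homology_class p X S 0"
  by (simp add: rat_homology_def)

lemma module_rat_homology: "module rat_field (rat_homology p X S)"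
proof (rule moduleI)
  show "cring rat_field"
    by (rule cring_rat_field)
  show "abelian_group (rat_homology p X S)"
  proof (rule abelian_groupI)
    show "\<exists>y\<in>carrier (rat_homology p X S). y \<oplus>\<^bsub>rat_homology p X S\<^esub> x = \<zero>\<^bsub>rat_homology p X S\<^esub>"
      if "x \<in> carrier (rat_homology p X S)" for x
    proof -
      obtain c where c: "x = rat_homology_class p X S c" "rat_relcycle p X S c"
        using \<open>x \<in> _\<close> by (auto simp: carrier_rat_homology)
      have "rat_relcycle p X S (- c)"
        using rat_relcycle_simps(3) [OF c(2), of "-1"] by (simp add: rat_cmul_simps)
      then show ?thesis
        by (intro bexI [of _ "rat_homology_class p X S (- c)"])
           (simp_all add: carrier_rat_homology zero_rat_homology c(1) rat_homology_add)
    qed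
  qed (auto simp: carrier_rat_homology zero_rat_homology rat_homology_add rat_relcycle_simps ac_simps)
qed (auto simp: carrier_rat_homology rat_homology_add rat_homology_smult rat_relcycle_simps
      rat_field_def rat_cmul_simps)

lemma rat_hom_induced_class:
  assumes "continuous_map X Y f" "f ` S \<subseteq> T"
  shows "rat_hom_induced p X S Y T f (rat_homology_class p X S c)
       = rat_homology_class p Y T (rat_chain_map p f c)"
proof -
  have sub: "continuous_map (subtopology X S) (subtopology Y T) f"
    using assms by (auto simp: continuous_map_in_subtopology continuous_map_from_subtopology)
  have bd: "rat_relboundary p Y T (rat_chain_map p f a)" if a: "rat_relboundary p X S a" for a
  proof -
    obtain d where d: "rat_singular_chain (Suc p) X d"
      "rat_singular_chain p (subtopology X S) (rat_chain_boundary (Suc p) d - a)"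
      using a by (auto simp: rat_relboundary_def)
    have "rat_chain_boundary (Suc p) (rat_chain_map (Suc p) f d) - rat_chain_map p f a
        = rat_chain_map p f (rat_chain_boundary (Suc p) d - a)"
      using rat_chain_boundary_chain_map [of "Suc p" f d] by (simp add: rat_chain_map_linear)
    then show ?thesis
      using rat_singular_chain_map [OF d(2) sub] rat_singular_chain_map [OF d(1) assms(1)]
      unfolding rat_relboundary_def by metis
  qed
  have "rat_homology_class p Y T (rat_chain_map p f a) = rat_homology_class p Y T (rat_chain_map p f c)"
    if "a \<in> rat_homology_class p X S c" for a
    using that bd [of "a - c"]
    by (simp add: mem_rat_homology_class rat_homology_class_eq_iff rat_chain_map_linear)
  moreover have "c \<in> rat_homology_class p X S c"
    by (simp add: mem_rat_homology_class)
  ultimately show ?thesis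
    unfolding rat_hom_induced_def by blast
qed

lemma rat_hom_induced_linear:
  fixes p :: nat and X :: "'a topology" and Y :: "'b topology" and S T f
  assumes f: "continuous_map X Y f" "f ` S \<subseteq> T"
  defines "H \<equiv> rat_homology p X S" and "K \<equiv> rat_homology p Y T"
    and "h \<equiv> rat_hom_induced p X S Y T f"
  assumes x: "x \<in> carrier H" and y: "y \<in> carrier H"
  shows "h x \<in> carrier K" "h (x \<oplus>\<^bsub>H\<^esub> y) = h x \<oplus>\<^bsub>K\<^esub> h y" "h (q \<odot>\<^bsub>H\<^esub> x) = q \<odot>\<^bsub>K\<^esub> h x"
proof -
  obtain c d where c: "x = rat_homology_class p X S c" "rat_relcycle p X S c"
    and d: "y = rat_homology_class p X S d"
    using x y by (auto simp: H_def rat_homology_def)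
  have sub: "continuous_map (subtopology X S) (subtopology Y T) f"
    using f by (auto simp: continuous_map_in_subtopology continuous_map_from_subtopology)
  have "rat_relcycle p Y T (rat_chain_map p f c)"
    using c(2) rat_singular_chain_map [OF _ f(1)] rat_singular_chain_map [OF _ sub]
    by (auto simp: rat_relcycle_def rat_chain_boundary_chain_map)
  then show "h x \<in> carrier K"
    by (simp add: h_def K_def c(1) rat_hom_induced_class [OF f]) (simp add: rat_homology_def)
  show "h (x \<oplus>\<^bsub>H\<^esub> y) = h x \<oplus>\<^bsub>K\<^esub> h y" "h (q \<odot>\<^bsub>H\<^esub> x) = q \<odot>\<^bsub>K\<^esub> h x"
    by (simp_all add: h_def H_def K_def c(1) d rat_homology_add rat_homology_smult
        rat_hom_induced_class [OF f] rat_chain_map_linear)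
qed


section \<open>Ring neighborhoods of the equator\<close>

text \<open>
  Points of \<open>nsphere n\<close> are sequences supported on the coordinates \<open>0,\<dots>,n\<close>, so for \<open>n \<ge> 1\<close> the
  sphere \<open>nsphere (n - 1)\<close> is literally the equator \<open>{x. x n = 0}\<close> of \<open>nsphere n\<close>
  (\<open>subtopology_nsphere_equator\<close>).
\<close>

abbreviation equator :: "nat \<Rightarrow> (nat \<Rightarrow> real) set"
  where "equator n \<equiv> topspace (nsphere (n - 1))"

definition triangulates :: "'k::euclidean_space set set \<Rightarrow> ('k \<Rightarrow> 'a) \<Rightarrow> 'a topology \<Rightarrow> bool"
  where "triangulates \<K> h X \<longleftrightarrow>
    simplicial_complex \<K> \<and> homeomorphic_map (top_of_set (\<Union>\<K>)) X h"

text \<open>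
  The type argument \<open>'k\<close> is the Euclidean space in which the complex triangulating the sphere lives.
  In a theorem that is polymorphic in \<open>'k\<close>, the hypothesis amounts to the existence of a
  triangulation in a Euclidean space of any dimension.
\<close>

definition ring_neighborhood :: "'k::euclidean_space itself \<Rightarrow> nat \<Rightarrow> (nat \<Rightarrow> real) set \<Rightarrow> bool"
  where "ring_neighborhood TYPE('k) n U \<longleftrightarrow>
    U \<subseteq> topspace (nsphere n) \<and>
    equator n \<subseteq> nsphere n interior_of U \<and>
    (\<exists>(\<K> :: 'k set set) \<L> h.
       triangulates \<K> h (nsphere n) \<and> \<L> \<subseteq> \<K> \<and> simplicial_complex \<L> \<and> U = h ` \<Union>\<L>) \<and>
    (\<exists>\<phi>. homeomorphic_map (subtopology (nsphere n) U)
            (prod_topology (nsphere (n - 1)) (top_of_set {-1..1::real})) \<phi> \<and>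
         \<phi> ` equator n = equator n \<times> {0})"

end

theory Submission
  imports Defs
begin

text \<open>
  A \<open>2 \<times> 2\<close> matrix with square \<open>0\<close> has trace and determinant \<open>0\<close>, so it suffices that \<open>f\<close>
  induces a map of square \<open>0\<close> on \<open>H\<^sub>n(S\<^sup>n,U;\<rat>)\<close>. Let \<open>\<delta>\<close> be the degree of \<open>f\<close> on \<open>S\<^sup>n\<close> and
  \<open>\<gamma>\<close> its degree on \<open>U \<simeq> S\<^sup>n\<^sup>-\<^sup>1\<close>. If \<open>\<delta> = \<gamma> = 0\<close>, the exact sequence of the pair shows that the
  square of the induced map vanishes on integral homology, and clearing denominators transfers this
  to rational homology.

  In place of the relative Lefschetz theorem, \<open>\<delta> = - \<gamma>\<close> is obtained from a homotopy. Squeeze \<open>f\<close>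
  on \<open>U\<close> towards the equator, keeping it fixed on the closure \<open>A\<close> of \<open>S\<^sup>n - U\<close>. Compare the result
  \<open>h\<close> with the map \<open>y\<close> that is the identity on \<open>A\<close> and slides every other point of \<open>U\<close> off the
  equator to the rim of \<open>U\<close>. Absence of fixed points in \<open>A\<close> makes \<open>h\<close> and \<open>y\<close> coincidence
  free, and a shear determined by \<open>y\<close> then deforms \<open>h\<close> into a map that swaps the two hemispheres
  and agrees with \<open>h\<close> on the equator; such a map is a suspension followed by a reflection. As
  \<open>f \<circ> f\<close> has no fixed points in \<open>A\<close> either, \<open>\<delta>\<^sup>2 = - \<gamma>\<^sup>2\<close> as well, whence \<open>\<delta> = \<gamma> = 0\<close>.
\<close>


section \<open>Degrees of maps compatible with the hemispheres\<close>

text \<open>The degree of \<open>f\<close> is the only integer by which the induced map can act as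
  multiplication. As \<open>j\<close> intertwines the two induced maps, multiplication by the degree
  of \<open>g\<close> is carried over to the target sphere.\<close>

lemma Brouwer_degree2_suspension_iso:
  assumes j: "j \<in> iso (reduced_homology_group (int m) (nsphere m)) (reduced_homology_group (int n) (nsphere n))"
    and f: "continuous_map (nsphere n) (nsphere n) f"
    and eq: "\<And>c. c \<in> carrier (reduced_homology_group (int m) (nsphere m)) \<Longrightarrow>
      hom_induced (int n) (nsphere n) {} (nsphere n) {} f (j c) = j (hom_induced (int m) (nsphere m) {} (nsphere m) {} g c)"
  shows "Brouwer_degree2 n f = Brouwer_degree2 m g"
proof (rule Brouwer_degree2_unique [OF f])
  let ?G = "reduced_homology_group (int m) (nsphere m)" and ?K = "reduced_homology_group (int n) (nsphere n)"
  interpret group_hom ?G ?K j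
    using j by (simp add: group_hom_def group_hom_axioms_def iso_def)
  fix x assume "x \<in> carrier ?K"
  then obtain c where c: "c \<in> carrier ?G" "x = j c"
    using j by (auto simp: iso_iff)
  then show "hom_induced (int n) (nsphere n) {} (nsphere n) {} f x = x [^]\<^bsub>?K\<^esub> Brouwer_degree2 m g"
    by (simp only: eq Brouwer_degree2 hom_int_pow)
qed

text \<open>Three isomorphisms link the homology of the equator to that of the sphere: the boundary
  map of the pair (upper hemisphere, equator), excision from this pair into (sphere, lower
  hemisphere), and the map from the absolute group to the latter pair. Since \<open>r\<close>
  preserves both hemispheres, all three commute with the maps it induces. The hypotheses speak of
  whole half-spaces because these are the sets by which the pairs are given.\<close>

lemma Brouwer_degree2_preserving_hemispheres_aux:
  fixes r :: "(nat \<Rightarrow> real) \<Rightarrow> nat \<Rightarrow> real"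
  assumes cmr: "continuous_map (nsphere (Suc n)) (nsphere (Suc n)) r"
    and rsub: "r \<in> {x. 0 \<le> x (Suc n)} \<rightarrow> {x. 0 \<le> x (Suc n)}"
      "r \<in> {x. x (Suc n) \<le> 0} \<rightarrow> {x. x (Suc n) \<le> 0}"
  shows "Brouwer_degree2 (Suc n) r = Brouwer_degree2 n r"
proof -
  define p where "p = int n"
  have sp: "int (Suc n) = 1 + p" by (simp add: p_def)
  have rsub3: "r \<in> {x. x (Suc n) = 0} \<rightarrow> {x. x (Suc n) = 0}"
    using rsub by (auto simp: Pi_iff intro: order_antisym)
  let ?sub = "subtopology (nsphere (Suc n)) {x. x (Suc n) \<ge> 0}"
  let ?E = "{x :: nat \<Rightarrow> real. x (Suc n) = 0}" and ?L = "{x :: nat \<Rightarrow> real. x (Suc n) \<le> 0}"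
  let ?G2 = "relative_homology_group (1 + p) ?sub ?E"
  let ?H2 = "relative_homology_group (1 + p) (nsphere (Suc n)) ?L"
  let ?r2 = "hom_induced (1 + p) ?sub ?E ?sub ?E r"
  let ?s2 = "hom_induced (1 + p) (nsphere (Suc n)) ?L (nsphere (Suc n)) ?L r"
  let ?j = "\<lambda>p n. hom_induced p (nsphere n) {} (nsphere n) {} r"
  have cmrs: "continuous_map ?sub ?sub r"
    using cmr rsub(1)
    by (auto simp: continuous_map_in_subtopology continuous_map_from_subtopology Pi_iff)
  have "\<exists>f \<in> iso (reduced_homology_group p (nsphere n)) (reduced_homology_group (1 + p) (nsphere (Suc n))).
        \<forall>c \<in> carrier (reduced_homology_group p (nsphere n)). ?j (1 + p) (Suc n) (f c) = f (?j p n c)"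
  proof (rule isomorphism_trans)
    let ?f = "hom_boundary (1 + p) ?sub ?E"
    show "\<exists>f\<in>iso (reduced_homology_group p (nsphere n)) ?G2.
           \<forall>c\<in>carrier (reduced_homology_group p (nsphere n)). ?r2 (f c) = f (?j p n c)"
    proof (rule isomorphism_sym)
      show "?f \<in> iso ?G2 (reduced_homology_group p (nsphere n))"
        using iso_upper_hemisphere_reduced_homology_group by (metis add.commute)
    next
      fix c assume "c \<in> carrier ?G2"
      have "?j p n \<circ> ?f = ?f \<circ> ?r2"
        using naturality_hom_induced [OF cmrs rsub3, symmetric, of "1+p", simplified]
        by (simp add: Pi_iff subtopology_subtopology subtopology_nsphere_equator flip: Collect_conj_eq cong: rev_conj_cong)
      then show "?j p n (?f c) = ?f (?r2 c)"
        by (metis comp_def)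
    next
      fix c assume "c \<in> carrier ?G2"
      show "?r2 c \<in> carrier ?G2"
        using hom_induced_carrier by blast
    qed auto
  next
    show "\<exists>f\<in>iso ?G2 (reduced_homology_group (1 + p) (nsphere (Suc n))).
        \<forall>c\<in>carrier ?G2. ?j (1 + p) (Suc n) (f c) = f (?r2 c)"
    proof (rule isomorphism_trans)
      show "\<exists>f\<in>iso ?G2 ?H2. \<forall>c\<in>carrier ?G2. ?s2 (f c) = f (?r2 c)"
      proof (intro ballI bexI)
        fix c assume "c \<in> carrier ?G2"
        have "?s2 (hom_induced (1 + p) ?sub ?E (nsphere (Suc n)) ?L id c)
            = hom_induced (1 + p) ?sub ?E (nsphere (Suc n)) ?L (r \<circ> id) c"
          by (rule hom_induced_compose') (use cmr rsub in auto)
        also have "\<dots> = hom_induced (1 + p) ?sub ?E (nsphere (Suc n)) ?L (id \<circ> r) c"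
          by simp
        also have "\<dots> = hom_induced (1 + p) ?sub ?E (nsphere (Suc n)) ?L id (?r2 c)"
          by (rule hom_induced_compose' [symmetric]) (use cmrs rsub3 in auto)
        finally show "?s2 (hom_induced (1 + p) ?sub ?E (nsphere (Suc n)) ?L id c)
            = hom_induced (1 + p) ?sub ?E (nsphere (Suc n)) ?L id (?r2 c)" .
      qed (simp add: iso_relative_homology_group_upper_hemisphere)
    next
      let ?h = "hom_induced (1 + p) (nsphere(Suc n)) {} (nsphere (Suc n)) ?L id"
      show "\<exists>f\<in>iso ?H2 (reduced_homology_group (1 + p) (nsphere (Suc n))).
               \<forall>c\<in>carrier ?H2. ?j (1 + p) (Suc n) (f c) = f (?s2 c)"
      proof (rule isomorphism_sym)
        show "?h \<in> iso (reduced_homology_group (1 + p) (nsphere (Suc n))) ?H2"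
          using iso_reduced_homology_group_lower_hemisphere by blast
      next
        fix c assume "c \<in> carrier (reduced_homology_group (1 + p) (nsphere (Suc n)))"
        show "?s2 (?h c) = ?h (?j (1 + p) (Suc n) c)"
          by (simp add: hom_induced_compose' cmr rsub)
      next
        fix c assume "c \<in> carrier (reduced_homology_group (1 + p) (nsphere (Suc n)))"
        then show "?j (1 + p) (Suc n) c \<in> carrier (reduced_homology_group (1 + p) (nsphere (Suc n)))"
          by (simp add: hom_induced_reduced)
      qed auto
    qed
  qed
  then show ?thesis
    unfolding p_def using Brouwer_degree2_suspension_iso [OF _ cmr] by (metis of_nat_Suc)
qed

lemma topspace_nsphere_subset_Suc: "topspace (nsphere n) \<subseteq> topspace (nsphere (Suc n))"
  by (metis inf_le1 subtopology_nsphere_equator topspace_subtopology)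

lemma Brouwer_degree2_preserving_hemispheres:
  assumes f: "continuous_map (nsphere (Suc n)) (nsphere (Suc n)) f"
    and pos: "\<And>x. x \<in> topspace (nsphere (Suc n)) \<Longrightarrow> 0 \<le> x (Suc n) \<Longrightarrow> 0 \<le> f x (Suc n)"
    and neg: "\<And>x. x \<in> topspace (nsphere (Suc n)) \<Longrightarrow> x (Suc n) \<le> 0 \<Longrightarrow> f x (Suc n) \<le> 0"
  shows "Brouwer_degree2 (Suc n) f = Brouwer_degree2 n f"
proof -
  \<comment> \<open>The zero sequence lies in both closed half-spaces, so this change off the sphere
    makes the half-space conditions hold everywhere and keeps the degrees.\<close>
  define r where "r x = (if x \<in> topspace (nsphere (Suc n)) then f x else (\<lambda>i. 0))" for x
  have "Brouwer_degree2 (Suc n) r = Brouwer_degree2 n r"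
  proof (rule Brouwer_degree2_preserving_hemispheres_aux)
    show "continuous_map (nsphere (Suc n)) (nsphere (Suc n)) r"
      using f by (rule continuous_map_eq) (simp add: r_def)
  qed (use pos neg in \<open>auto simp: r_def\<close>)
  moreover have "Brouwer_degree2 (Suc n) r = Brouwer_degree2 (Suc n) f"
    by (rule Brouwer_degree2_eq) (simp add: r_def)
  moreover have "Brouwer_degree2 n r = Brouwer_degree2 n f"
    using topspace_nsphere_subset_Suc by (intro Brouwer_degree2_eq) (auto simp: r_def)
  ultimately show ?thesis by simp
qed

lemma nsphere_conv_top_of_set:
  "nsphere n = top_of_set {x. (\<Sum>i\<le>n. (x i)\<^sup>2) = 1 \<and> (\<forall>i>n. x i = 0)}"
  by (simp add: nsphere euclidean_product_topology)

text \<open>Conjugation by the swap \<open>s\<close> of the coordinates 0 and \<open>k\<close> turns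
  this map into the reflection in coordinate 0. The degree of \<open>s\<close> squares to 1, so
  conjugation does not change the degree.\<close>

lemma Brouwer_degree2_reflection_gen:
  assumes "k \<le> n"
  shows "Brouwer_degree2 n (\<lambda>x i. if i = k then - x i else x i) = -1"
proof -
  define s where "s = (\<lambda>(x::nat \<Rightarrow> real) i. x (Transposition.transpose 0 k i))"
  define r where "r k = (\<lambda>(x::nat \<Rightarrow> real) i. if i = k then - x i else x i)" for k :: nat
  have perm: "Transposition.transpose 0 k permutes {..n}"
    using assms by (simp add: permutes_swap_id)
  have sp: "s x \<in> topspace (nsphere n)" if "x \<in> topspace (nsphere n)" for x
  proof -
    have "(\<Sum>i\<le>n. (x (Transposition.transpose 0 k i))\<^sup>2) = (\<Sum>i\<le>n. (x i)\<^sup>2)"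
      using sum.permute [OF perm, of "\<lambda>i. (x i)\<^sup>2"] by (simp add: o_def)
    then show ?thesis
      using that permutes_not_in [OF perm] by (auto simp: s_def nsphere)
  qed
  have cs: "continuous_map (nsphere n) (nsphere n) s"
    using sp unfolding nsphere_conv_top_of_set s_def
    by (auto intro!: continuous_on_coordinatewise_then_product continuous_on_subset [OF continuous_on_product_coordinates])
  have cr: "continuous_map (nsphere n) (nsphere n) (r j)" for j
    unfolding r_def by (rule continuous_map_nsphere_reflection)
  have "s \<circ> s = id"
    by (auto simp: s_def fun_eq_iff)
  then have ss: "Brouwer_degree2 n s * Brouwer_degree2 n s = 1"
    using Brouwer_degree2_compose [OF cs cs] by simp
  have "r k = s \<circ> (r 0 \<circ> s)"
    by (auto simp: s_def r_def fun_eq_iff Transposition.transpose_def)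
  then have "Brouwer_degree2 n (r k) = Brouwer_degree2 n s * (Brouwer_degree2 n (r 0) * Brouwer_degree2 n s)"
    using cs cr by (simp add: Brouwer_degree2_compose continuous_map_compose)
  also have "\<dots> = -1"
    using ss by (simp add: r_def Brouwer_degree2_reflection)
  finally show ?thesis by (simp add: r_def)
qed

text \<open>Composition with the reflection \<open>r\<close> in the last coordinate gives a map that
  preserves both hemispheres. On the equator \<open>f\<close> has last coordinate 0, so
  \<open>r\<close> changes nothing there.\<close>

lemma Brouwer_degree2_swapping_hemispheres:
  assumes f: "continuous_map (nsphere (Suc n)) (nsphere (Suc n)) f"
    and pos: "\<And>x. x \<in> topspace (nsphere (Suc n)) \<Longrightarrow> 0 \<le> x (Suc n) \<Longrightarrow> f x (Suc n) \<le> 0"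
    and neg: "\<And>x. x \<in> topspace (nsphere (Suc n)) \<Longrightarrow> x (Suc n) \<le> 0 \<Longrightarrow> 0 \<le> f x (Suc n)"
  shows "Brouwer_degree2 (Suc n) f = - Brouwer_degree2 n f"
proof -
  define r where "r = (\<lambda>(x::nat \<Rightarrow> real) i. if i = Suc n then - x i else x i)"
  have cr: "continuous_map (nsphere (Suc n)) (nsphere (Suc n)) r"
    unfolding r_def by (rule continuous_map_nsphere_reflection)
  have "- Brouwer_degree2 (Suc n) f = Brouwer_degree2 (Suc n) (r \<circ> f)"
    using Brouwer_degree2_compose [OF f cr] Brouwer_degree2_reflection_gen [of "Suc n" "Suc n"]
    by (simp add: r_def)
  also have "\<dots> = Brouwer_degree2 n (r \<circ> f)"
    using pos neg by (intro Brouwer_degree2_preserving_hemispheres continuous_map_compose [OF f cr]) (auto simp: r_def)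
  also have "\<dots> = Brouwer_degree2 n f"
  proof (rule Brouwer_degree2_eq)
    fix x assume "x \<in> topspace (nsphere n)"
    then have "x \<in> topspace (nsphere (Suc n))" "x (Suc n) = 0"
      using topspace_nsphere_subset_Suc by (auto simp: nsphere)
    then have "f x (Suc n) = 0"
      using pos neg by (intro order_antisym) auto
    then show "(r \<circ> f) x = f x"
      by (auto simp: r_def)
  qed
  finally show ?thesis by simp
qed


section \<open>Coincidence-free maps\<close>

lemma topspace_nsphere_iff:
  "x \<in> topspace (nsphere n) \<longleftrightarrow> (\<Sum>i\<le>n. (x i)\<^sup>2) = 1 \<and> (\<forall>i>n. x i = 0)"
  by (simp add: nsphere)

lemma nsphere_eq_top_of_set: "nsphere n = top_of_set (topspace (nsphere n))"
  by (simp add: nsphere_conv_top_of_set)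

lemma continuous_map_nsphere_iff:
  "continuous_map (nsphere m) (nsphere n) f \<longleftrightarrow>
    continuous_on (topspace (nsphere m)) f \<and> f ` topspace (nsphere m) \<subseteq> topspace (nsphere n)"
  by (auto simp: nsphere_conv_top_of_set)

lemma topspace_nsphere_Suc_iff:
  "x \<in> topspace (nsphere n) \<longleftrightarrow> x \<in> topspace (nsphere (Suc n)) \<and> x (Suc n) = 0"
proof
  assume "x \<in> topspace (nsphere n)"
  then show "x \<in> topspace (nsphere (Suc n)) \<and> x (Suc n) = 0"
    by (simp add: topspace_nsphere_iff)
next
  assume "x \<in> topspace (nsphere (Suc n)) \<and> x (Suc n) = 0"
  then show "x \<in> topspace (nsphere n)"
    using topspace_nsphere_minus1 [of x "Suc n"] by simp
qed

lemma nsphere_nonzero: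
  assumes "x \<in> topspace (nsphere n)"
  shows "\<exists>i\<le>n. x i \<noteq> 0"
proof (rule ccontr)
  assume "\<not> ?thesis"
  then have "(\<Sum>i\<le>n. (x i)\<^sup>2) = 0" by (intro sum.neutral) auto
  then show False using assms by (simp add: topspace_nsphere_iff)
qed

section \<open>Radial projection and homotopies of sphere maps\<close>

definition sphere_proj :: "nat \<Rightarrow> (nat \<Rightarrow> real) \<Rightarrow> nat \<Rightarrow> real"
  where "sphere_proj n v = (\<lambda>i. v i / sqrt (\<Sum>j\<le>n. (v j)\<^sup>2))"

lemma sum_squares_pos: "\<exists>i\<le>(n::nat). v i \<noteq> 0 \<Longrightarrow> (0::real) < (\<Sum>j\<le>n. (v j)\<^sup>2)"
proof -
  assume "\<exists>i\<le>n. v i \<noteq> 0"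
  then obtain i where "i \<le> n" "v i \<noteq> 0" by blast
  then show ?thesis
    by (intro sum_pos2 [of _ i]) auto
qed

lemma sphere_proj_in:
  assumes "\<exists>i\<le>n. v i \<noteq> 0" "\<And>i. i > n \<Longrightarrow> v i = 0"
  shows "sphere_proj n v \<in> topspace (nsphere n)"
proof -
  have "(\<Sum>i\<le>n. (sphere_proj n v i)\<^sup>2) = (\<Sum>i\<le>n. (v i)\<^sup>2) / (\<Sum>j\<le>n. (v j)\<^sup>2)"
    using sum_squares_pos [OF assms(1)] by (simp add: sphere_proj_def power_divide flip: sum_divide_distrib)
  then show ?thesis
    using sum_squares_pos [OF assms(1)] assms(2) by (simp add: topspace_nsphere_iff sphere_proj_def)
qed

lemma sphere_proj_id: "x \<in> topspace (nsphere n) \<Longrightarrow> sphere_proj n x = x"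
  by (simp add: topspace_nsphere_iff sphere_proj_def)

lemma continuous_on_coord: "continuous_on A H \<Longrightarrow> continuous_on A (\<lambda>x. H x i)"
  for H :: "'a::topological_space \<Rightarrow> nat \<Rightarrow> real"
  by (rule continuous_on_product_then_coordinatewise)

lemma continuous_on_sphere_proj:
  assumes "\<And>i. i \<le> n \<Longrightarrow> continuous_on A (\<lambda>x. H x i)"
    and "\<And>x. x \<in> A \<Longrightarrow> \<exists>i\<le>n. H x i \<noteq> 0" and "\<And>x i. x \<in> A \<Longrightarrow> i > n \<Longrightarrow> H x i = 0"
  shows "continuous_on A (\<lambda>x. sphere_proj n (H x))"
proof (rule continuous_on_coordinatewise_then_product)
  fix i
  show "continuous_on A (\<lambda>x. sphere_proj n (H x) i)"
  proof (cases "i \<le> n")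
    case True
    then show ?thesis
      unfolding sphere_proj_def
      using sum_squares_pos [OF assms(2)] assms(1)
      by (intro continuous_intros) (auto simp: less_imp_neq [symmetric])
  next
    case False
    then show ?thesis
      using assms(3) by (simp add: sphere_proj_def cong: continuous_on_cong)
  qed
qed

lemma homotopic_nsphere:
  fixes H :: "real \<times> (nat \<Rightarrow> real) \<Rightarrow> nat \<Rightarrow> real"
  assumes "continuous_on ({0..1} \<times> topspace (nsphere m)) H"
    and "\<And>t x. t \<in> {0..1} \<Longrightarrow> x \<in> topspace (nsphere m) \<Longrightarrow> H (t, x) \<in> topspace (nsphere n)"
  shows "homotopic_with (\<lambda>x. True) (nsphere m) (nsphere n) (\<lambda>x. H (0, x)) (\<lambda>x. H (1, x))"
proof -
  have "continuous_map (prod_topology (top_of_set {0..1}) (nsphere m)) (nsphere n) H"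
    using assms by (auto simp: nsphere_conv_top_of_set simp flip: subtopology_Times)
  then show ?thesis
    unfolding homotopic_with_def by - (rule exI [of _ H], simp)
qed

text \<open>A family of vectors need only avoid zero, since radial projection then makes it a
  homotopy of sphere maps. Both deformations \<open>V\<close> and \<open>W\<close> below are given
  in this form.\<close>

lemma homotopic_sphere_proj:
  fixes H :: "real \<times> (nat \<Rightarrow> real) \<Rightarrow> nat \<Rightarrow> real"
  assumes "\<And>i. i \<le> n \<Longrightarrow> continuous_on ({0..1} \<times> topspace (nsphere m)) (\<lambda>z. H z i)"
    and "\<And>t x. t \<in> {0..1} \<Longrightarrow> x \<in> topspace (nsphere m) \<Longrightarrow> \<exists>i\<le>n. H (t, x) i \<noteq> 0"
    and "\<And>t x i. t \<in> {0..1} \<Longrightarrow> x \<in> topspace (nsphere m) \<Longrightarrow> i > n \<Longrightarrow> H (t, x) i = 0"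
  shows "homotopic_with (\<lambda>x. True) (nsphere m) (nsphere n)
          (\<lambda>x. sphere_proj n (H (0, x))) (\<lambda>x. sphere_proj n (H (1, x)))"
  using assms by (intro homotopic_nsphere continuous_on_sphere_proj sphere_proj_in) auto

text \<open>Domination by a function that vanishes on \<open>E\<close> forces the limit 0 at points
  of \<open>E\<close>. This gives continuity across the equator for a function built from a map
  \<open>y\<close> that is assumed continuous only off the equator.\<close>

lemma continuous_on_extend_by_bound:
  fixes g :: "'a::metric_space \<Rightarrow> real" and b :: "'a \<Rightarrow> real"
  assumes "continuous_on (S - E) g" "closed E" and b: "continuous_on S b"
    and "\<And>x. x \<in> S \<Longrightarrow> \<bar>g x\<bar> \<le> b x" "\<And>x. x \<in> S \<inter> E \<Longrightarrow> b x = 0"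
  shows "continuous_on S g"
  unfolding continuous_on_def
proof
  fix x assume x: "x \<in> S"
  show "tendsto g (g x) (at x within S)"
  proof (cases "x \<in> E")
    case True
    have gx: "g x = 0" "b x = 0"
      using assms(4) [OF x] assms(5) [of x] x True by auto
    have "tendsto b 0 (at x within S)"
      using b x gx by (metis continuous_on_def)
    then show ?thesis
      unfolding gx
      by (rule Lim_null_comparison [rotated])
         (use assms(4) in \<open>auto simp: eventually_at_filter\<close>)
  next
    case False
    have "open (- E)" using assms(2) by auto
    then have "at x within (S - E) = at x within S"
      using False by (intro at_within_nhd [of x "- E"]) auto
    then show ?thesis
      using assms(1) x False by (metis DiffI continuous_on_def)
  qed
qed

text \<open>
  A vector with components \<open>h - s M\<close> and last component unchanged is a shear that fixes the equator
  pointwise and, at \<open>s = 1\<close>, moves \<open>y z\<close> to the pole of the hemisphere of \<open>z\<close>. As \<open>h z \<noteq> y z\<close>, the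
  sheared map misses that pole and can be pushed into the opposite hemisphere.
\<close>

lemma Brouwer_degree2_coincidence_free:
  fixes h y :: "(nat \<Rightarrow> real) \<Rightarrow> nat \<Rightarrow> real" and m :: nat and e :: real
  defines "S \<equiv> topspace (nsphere (Suc m))" and "E \<equiv> topspace (nsphere m)"
  assumes h: "continuous_on S h" "h ` S \<subseteq> S" "h ` E \<subseteq> E"
    and y: "continuous_on (S - E) y" "y ` (S - E) \<subseteq> S"
    and sgn: "\<And>z. z \<in> S - E \<Longrightarrow> 0 < y z (Suc m) * z (Suc m)"
    and bound: "e > 0" "\<And>z. z \<in> S - E \<Longrightarrow> e \<le> \<bar>y z (Suc m)\<bar>"
    and neq: "\<And>z. z \<in> S - E \<Longrightarrow> h z \<noteq> y z"
  shows "Brouwer_degree2 (Suc m) h = - Brouwer_degree2 m h"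
proof -
  define n where "n = Suc m"
  \<comment> \<open>When \<open>h z\<close> and \<open>y z\<close> lie in the same open hemisphere,
    \<open>M z\<close> is the multiple of \<open>y z\<close> with last coordinate
    \<open>h z n\<close>; in opposite ones the cut-off at 0 makes it vanish.\<close>
  define M where "M z i = max 0 (h z n / y z n) * y z i" for z i
  \<comment> \<open>\<open>V\<close> performs the shear and fixes the last coordinate;
    \<open>W\<close> starts where \<open>V\<close> ends and moves the last coordinate to
    \<open>- z n\<close>.\<close>
  define V where "V = (\<lambda>(s, z) i. if i = n then h z n else if i < n then h z i - s * M z i else 0)"
  define W where "W = (\<lambda>(s, z) i. if i = n then (1 - s) * h z n - s * z n else if i < n then h z i - M z i else 0)"
  have S_eq: "S = topspace (nsphere n)"
    by (simp add: S_def n_def)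
  have E_iff: "z \<in> E \<longleftrightarrow> z \<in> S \<and> z n = 0" for z
    unfolding S_def E_def n_def by (rule topspace_nsphere_Suc_iff)
  have hE: "h z n = 0" if "z \<in> E" for z
    using h(3) that E_iff by auto
  have MhE: "M z i = 0" if "h z n = 0" for z i
    using that by (simp add: M_def)
  have Sabs: "\<bar>x i\<bar> \<le> 1" if "x \<in> S" for x i
    using that topspace_nsphere_1 [of x "Suc m" i] unfolding S_def by (simp add: abs_square_le_1)
  have S0: "x i = 0" if "x \<in> S" "i > n" for x i
    using that by (auto simp: S_eq topspace_nsphere_iff)
  have hnz: "\<exists>i<n. h z i \<noteq> 0" if "z \<in> S" "h z n = 0" for z
  proof -
    have "h z \<in> topspace (nsphere n)"
      using that h(2) by (auto simp: S_eq)
    then obtain i where i: "i \<le> n" "h z i \<noteq> 0"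
      using nsphere_nonzero by blast
    with that have "i \<noteq> n" by auto
    with i show ?thesis by (intro exI [of _ i]) auto
  qed
  \<comment> \<open>Off the equator \<open>y\<close> has height at least \<open>e\<close> and
    components bounded by 1, so \<open>M\<close> is dominated by
    \<open>\<bar>h z n\<bar> / e\<close>. This bound vanishes on the equator, which \<open>h\<close>
    preserves.\<close>
  have contM: "continuous_on S (\<lambda>z. M z i)" if "i \<le> n" for i
  proof (rule continuous_on_extend_by_bound [where E = "{z. z n = 0}" and b = "\<lambda>z. \<bar>h z n\<bar> / e"])
    have ch: "continuous_on S (\<lambda>z. h z j)" and cy: "continuous_on (S - E) (\<lambda>z. y z j)" for j
      using h(1) y(1) by (auto intro: continuous_on_coord)
    have ynz: "y z n \<noteq> 0" if "z \<in> S - E" for z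
      using sgn [OF that] by (auto simp: n_def)
    have "continuous_on (S - E) (\<lambda>z. M z i)"
      unfolding M_def
      by (intro continuous_intros cy continuous_on_subset [OF ch])
         (use ynz in auto)
    moreover have "S - {z. z n = 0} = S - E"
      by (auto simp: E_iff)
    ultimately show "continuous_on (S - {z. z n = 0}) (\<lambda>z. M z i)"
      by simp
    show "closed {z. z n = (0::real)}"
      by (intro closed_Collect_eq continuous_intros continuous_on_product_coordinates)
    show "continuous_on S (\<lambda>z. \<bar>h z n\<bar> / e)"
      using bound by (intro continuous_intros ch) auto
    show "\<bar>M z i\<bar> \<le> \<bar>h z n\<bar> / e" if z: "z \<in> S" for z
    proof (cases "z \<in> E")
      case True
      then show ?thesis by (simp add: MhE hE)
    next
      case False
      with z have ye: "e \<le> \<bar>y z n\<bar>" "y z \<in> S"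
        using bound y by (auto simp: n_def)
      have "\<bar>M z i\<bar> \<le> \<bar>h z n / y z n\<bar> * 1"
        unfolding M_def abs_mult using Sabs [OF ye(2)] by (intro mult_mono) (simp_all del: abs_divide)
      also have "\<dots> \<le> \<bar>h z n\<bar> / e"
        using ye bound by (auto simp: abs_divide intro!: divide_left_mono mult_pos_pos)
      finally show ?thesis .
    qed
    show "\<bar>h z n\<bar> / e = 0" if "z \<in> S \<inter> {z. z n = 0}" for z
      using that hE E_iff by auto
  qed
  have coord: "continuous_on ({0..1} \<times> S) (\<lambda>z. h (snd z) i)" "continuous_on ({0..1} \<times> S) (\<lambda>z. snd z i)" for i
    by (rule continuous_on_compose2 [OF continuous_on_coord [OF h(1)]], auto intro: continuous_intros)
       (rule continuous_on_compose2 [OF continuous_on_product_coordinates], auto intro: continuous_intros)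
  have coordM: "continuous_on ({0..1} \<times> S) (\<lambda>z. M (snd z) i)" if "i \<le> n" for i
    by (rule continuous_on_compose2 [OF contM [OF that]]) (auto intro: continuous_intros)
  have "homotopic_with (\<lambda>x. True) (nsphere n) (nsphere n) (\<lambda>x. sphere_proj n (V (0, x))) (\<lambda>x. sphere_proj n (V (1, x)))"
  proof (rule homotopic_sphere_proj; fold n_def S_eq)
    show "continuous_on ({0..1} \<times> S) (\<lambda>z. V z i)" if "i \<le> n" for i
      using that unfolding V_def case_prod_unfold
      by (cases "i = n") (auto intro!: continuous_intros coord coordM)
    \<comment> \<open>The shear keeps the last coordinate, and where that is 0 it does nothing at
      all.\<close>
    show "\<exists>i\<le>n. V (t, x) i \<noteq> 0" if "t \<in> {0..1}" "x \<in> S" for t x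
    proof (cases "h x n = 0")
      case True
      then show ?thesis
        using hnz [OF that(2)] by (fastforce simp: V_def MhE)
    qed (auto simp: V_def)
  qed (auto simp: V_def)
  moreover have "sphere_proj n (V (0, z)) = h z" if "z \<in> S" for z
  proof -
    have hz: "h z \<in> S" using h that by auto
    have "V (0, z) = h z"
      using S0 [OF hz] by (auto simp: V_def fun_eq_iff)
    then show ?thesis
      using hz by (simp add: sphere_proj_id S_eq)
  qed
  ultimately have d1: "Brouwer_degree2 n h = Brouwer_degree2 n (\<lambda>x. sphere_proj n (V (1, x)))"
    using Brouwer_degree2_eq [of n h "\<lambda>x. sphere_proj n (V (0, x))"]
    by (simp add: Brouwer_degree2_homotopic S_eq)
  \<comment> \<open>At a zero of \<open>W\<close>, \<open>h z\<close> agrees with \<open>M z\<close>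
    below \<open>n\<close>. If \<open>h z n\<close> and \<open>y z n\<close> have the same sign,
    \<open>h z\<close> is a positive multiple of the unit vector \<open>y z\<close>, hence equal to
    it. If the signs differ, the two terms of the last component have the same sign and cannot
    cancel.\<close>
  have Wnz: "\<exists>i\<le>n. W (t, z) i \<noteq> 0" if t: "t \<in> {0..1}" and z: "z \<in> S" for t z
  proof (cases "h z n = 0")
    case True
    then show ?thesis
      using hnz [OF z] by (fastforce simp: W_def MhE)
  next
    case hn: False
    then have zE: "z \<in> S - E" using hE z by auto
    have yS: "y z \<in> S" "h z \<in> S" using y zE h z by auto
    show ?thesis
    proof (rule ccontr)
      assume "\<not> ?thesis"
      then have W0: "W (t, z) i = 0" if "i \<le> n" for i using that by auto
      have lin: "(1 - t) * h z n = t * z n"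
        using W0 [of n] by (simp add: W_def)
      have hM: "h z i = M z i" if "i < n" for i
        using W0 [of i] that by (simp add: W_def)
      show False
      proof (cases "h z n / y z n > 0")
        case True
        define q where "q = h z n / y z n"
        have yn: "y z n \<noteq> 0" using sgn [OF zE] by (auto simp: n_def)
        have hq: "h z i = q * y z i" if "i \<le> n" for i
          using that hM [of i] True yn by (cases "i = n") (auto simp: M_def q_def max_def)
        have "1 = (\<Sum>i\<le>n. (h z i)\<^sup>2)"
          using yS by (simp add: S_eq topspace_nsphere_iff)
        also have "\<dots> = q\<^sup>2 * (\<Sum>i\<le>n. (y z i)\<^sup>2)"
          by (simp add: hq power_mult_distrib sum_distrib_left)
        also have "\<dots> = q\<^sup>2"
          using yS by (simp add: S_eq topspace_nsphere_iff)
        finally have "q = 1"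
          using True by (simp add: q_def power2_eq_1_iff)
        then have "h z = y z"
          using hq S0 [OF yS(1)] S0 [OF yS(2)] by (simp add: fun_eq_iff) (metis not_le)
        then show False using neq zE by blast
      next
        case False
        have "M z i = 0" for i
          using False by (auto simp: M_def max_def)
        have "0 < y z n * z n" using sgn zE by (simp add: n_def)
        have "(h z n / y z n) * (y z n * z n) \<le> 0"
          using False \<open>0 < y z n * z n\<close> by (intro mult_nonpos_nonneg) auto
        then have neg: "h z n * z n < 0"
          using \<open>0 < y z n * z n\<close> hn by (auto simp: order_less_le)
        have "(1 - t) * (h z n * z n) = t * (z n)\<^sup>2"
          using lin by (simp add: power2_eq_square)
        moreover have "0 \<le> t * (z n)\<^sup>2" "(1 - t) * (h z n * z n) \<le> 0"
          using t neg by (auto intro: mult_nonneg_nonpos)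
        ultimately have "t * (z n)\<^sup>2 = 0" "(1 - t) * (h z n * z n) = 0" by auto
        then show False using neg by auto
      qed
    qed
  qed
  have W0: "i > n \<Longrightarrow> W (t, x) i = 0" for t x i
    by (auto simp: W_def)
  have contW: "continuous_on ({0..1} \<times> S) (\<lambda>z. W z i)" if "i \<le> n" for i
    using that unfolding W_def case_prod_unfold
    by (cases "i = n") (auto intro!: continuous_intros coord coordM)
  have "homotopic_with (\<lambda>x. True) (nsphere n) (nsphere n) (\<lambda>x. sphere_proj n (W (0, x))) (\<lambda>x. sphere_proj n (W (1, x)))"
    by (rule homotopic_sphere_proj; fold n_def S_eq)
       (use contW Wnz W0 in auto)
  moreover have "W (0, x) = V (1, x)" for x
    by (auto simp: W_def V_def fun_eq_iff)
  ultimately have d2: "Brouwer_degree2 n h = Brouwer_degree2 n (\<lambda>x. sphere_proj n (W (1, x)))"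
    using d1 by (simp add: Brouwer_degree2_homotopic)
  \<comment> \<open>At the end of the deformation the last coordinate is \<open>- z n\<close> up to
    a positive factor, so the hemispheres are swapped.\<close>
  have "Brouwer_degree2 n (\<lambda>x. sphere_proj n (W (1, x))) = - Brouwer_degree2 m (\<lambda>x. sphere_proj n (W (1, x)))"
    unfolding n_def
  proof (rule Brouwer_degree2_swapping_hemispheres; fold n_def S_eq)
    have "continuous_on S (\<lambda>x. sphere_proj n (W (1, x)))"
      using Wnz W0
      by (intro continuous_on_sphere_proj continuous_on_compose2 [OF contW] continuous_intros) auto
    moreover have "sphere_proj n (W (1, x)) \<in> S" if "x \<in> S" for x
      unfolding S_eq using Wnz W0 that by (intro sphere_proj_in) auto
    ultimately show "continuous_map (nsphere n) (nsphere n) (\<lambda>x. sphere_proj n (W (1, x)))"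
      by (auto simp: continuous_map_nsphere_iff S_eq)
  qed (auto simp: sphere_proj_def W_def intro!: divide_nonpos_nonneg divide_nonneg_nonneg sum_nonneg)
  \<comment> \<open>On the equator \<open>z n\<close> and \<open>h z n\<close> are both 0, so
    neither deformation moves \<open>h z\<close>.\<close>
  also have "Brouwer_degree2 m (\<lambda>x. sphere_proj n (W (1, x))) = Brouwer_degree2 m h"
  proof (rule Brouwer_degree2_eq)
    fix x assume "x \<in> topspace (nsphere m)"
    then have xE: "x \<in> E" by (simp add: E_def)
    then have hx: "h x \<in> S" "h x n = 0" "x n = 0"
      using h E_iff by auto
    have "W (1, x) = h x"
      using hx S0 [OF hx(1)] by (auto simp: W_def fun_eq_iff MhE)
    then show "sphere_proj n (W (1, x)) = h x"
      using hx by (simp add: sphere_proj_id S_eq)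
  qed
  finally show ?thesis
    using d2 by (simp add: n_def)
qed


section \<open>Invariance of domain on the sphere\<close>

lemma Euclidean_space_conv_top_of_set: "Euclidean_space n = top_of_set {x. \<forall>i\<ge>n. x i = 0}"
  by (simp add: Euclidean_space_def euclidean_product_topology)

text \<open>The unit norm determines the missing coordinate \<open>k\<close> up to sign, and the
  hemisphere fixes the sign. For \<open>k < n\<close>, coordinate \<open>n\<close> is stored in slot
  \<open>k\<close>, so that the values are supported below \<open>n\<close>.\<close>

lemma inj_on_drop_coordinate:
  assumes "k \<le> n"
  shows "inj_on (\<lambda>x i. if i < n then if i = k then x n else x i else 0)
          {x \<in> topspace (nsphere n). 0 < s * x k}"
proof (rule inj_onI)
  fix x y
  assume x: "x \<in> {x \<in> topspace (nsphere n). 0 < s * x k}"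
    and y: "y \<in> {x \<in> topspace (nsphere n). 0 < s * x k}"
    and eq: "(\<lambda>i. if i < n then if i = k then x n else x i else 0)
      = (\<lambda>i. if i < n then if i = k then y n else y i else 0)"
  have ne: "x i = y i" if "i \<le> n" "i \<noteq> k" for i
    using fun_cong [OF eq, of i] fun_cong [OF eq, of k] that assms
    by (cases "i = n") (auto split: if_splits)
  have "(\<Sum>i\<in>{..n} - {k}. (x i)\<^sup>2) = (\<Sum>i\<in>{..n} - {k}. (y i)\<^sup>2)"
    by (rule sum.cong) (auto simp: ne)
  then have "(x k)\<^sup>2 = (y k)\<^sup>2"
    using x y assms by (simp add: topspace_nsphere_iff sum.remove [of "{..n}" k])
  then have "x k = y k"
    using x y by (auto simp: power2_eq_iff)
  with ne have "x i = y i" for i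
    using x y by (cases "i \<le> n"; cases "i = k") (auto simp: topspace_nsphere_iff)
  then show "x = y" by blast
qed

text \<open>Each point of the image has a nonzero coordinate \<open>k\<close>. On the open
  hemisphere around it, dropping this coordinate is a chart, and Euclidean invariance of domain
  applies to \<open>g\<close> followed by the chart.\<close>

lemma invariance_of_domain_nsphere:
  assumes W: "openin (Euclidean_space n) W" and g: "continuous_on W g" "inj_on g W"
    and gW: "g ` W \<subseteq> topspace (nsphere n)"
  shows "openin (nsphere n) (g ` W)"
proof (subst openin_subopen, intro ballI)
  fix q assume "q \<in> g ` W"
  then obtain v where v: "v \<in> W" "q = g v" by blast
  then have "q \<in> topspace (nsphere n)" using gW by blast
  then obtain k where k: "k \<le> n" "q k \<noteq> 0" using nsphere_nonzero by blast
  \<comment> \<open>Only the sign of \<open>s\<close> matters: it makes \<open>H\<close> the open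
    hemisphere that contains \<open>q\<close>.\<close>
  define s where "s = q k"
  define p where "p = (\<lambda>(x::nat \<Rightarrow> real) i. if i < n then if i = k then x n else x i else 0)"
  let ?S = "topspace (nsphere n)"
  define H where "H = {x \<in> ?S. 0 < s * x k}"
  define W' where "W' = {w \<in> W. g w \<in> H}"
  have W'_eq: "W' = W \<inter> (\<lambda>w. s * g w k) -` {0<..}"
    using gW by (auto simp: W'_def H_def)
  have "continuous_on W (\<lambda>w. s * g w k)"
    using g by (intro continuous_on_mult_left continuous_on_coord)
  then have "openin (top_of_set W) W'"
    unfolding W'_eq by (rule continuous_openin_preimage_gen) simp
  then have "openin (Euclidean_space n) W'"
    using W openin_trans unfolding Euclidean_space_conv_top_of_set by blast
  moreover
  have contp: "continuous_on A p" for A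
  proof (rule continuous_on_coordinatewise_then_product)
    show "continuous_on A (\<lambda>x. p x i)" for i
      by (cases "i < n"; cases "i = k")
         (auto simp: p_def intro: continuous_on_subset [OF continuous_on_product_coordinates])
  qed
  have "continuous_on W' (p \<circ> g)"
    by (intro continuous_on_compose contp continuous_on_subset [OF g(1)]) (auto simp: W'_def)
  then have "continuous_map (subtopology (Euclidean_space n) W') (Euclidean_space n) (p \<circ> g)"
    unfolding Euclidean_space_conv_top_of_set
    by (auto simp: subtopology_subtopology p_def intro: continuous_on_subset)
  moreover have "inj_on (p \<circ> g) W'"
  proof (rule comp_inj_on)
    show "inj_on g W'"
      using g(2) by (rule inj_on_subset) (auto simp: W'_def)
    have "inj_on p H"
      unfolding p_def H_def using k(1) by (rule inj_on_drop_coordinate)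
    then show "inj_on p (g ` W')"
      by (rule inj_on_subset) (auto simp: W'_def)
  qed
  ultimately have op: "openin (Euclidean_space n) ((p \<circ> g) ` W')"
    by (rule invariance_of_domain_Euclidean_space)
  \<comment> \<open>Injectivity of \<open>p\<close> on \<open>H\<close> exhibits the image as the
    part of \<open>H\<close> lying over an open set of the chart.\<close>
  have eq: "g ` W' = {x \<in> ?S. s * x k \<in> {0<..}} \<inter> {x \<in> ?S. p x \<in> (p \<circ> g) ` W'}"
  proof -
    have "x \<in> g ` W'" if x: "x \<in> H" and px: "p x \<in> (p \<circ> g) ` W'" for x
    proof -
      obtain w where w: "w \<in> W'" "p x = (p \<circ> g) w" using px by blast
      have "inj_on p H"
        unfolding p_def H_def using k(1) by (rule inj_on_drop_coordinate)
      then have "x = g w"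
        using w x by (simp add: W'_def inj_on_def)
      then show ?thesis using w by blast
    qed
    then show ?thesis
      by (auto simp: H_def W'_def)
  qed
  have op1: "openin (nsphere n) {x \<in> ?S. s * x k \<in> {0<..}}"
    by (rule openin_continuous_map_preimage [of _ euclideanreal])
       (auto intro!: continuous_intros continuous_map_nsphere_projection)
  have op2: "openin (nsphere n) {x \<in> ?S. p x \<in> (p \<circ> g) ` W'}"
  proof (rule openin_continuous_map_preimage [OF _ op])
    show "continuous_map (nsphere n) (Euclidean_space n) p"
      unfolding nsphere_conv_top_of_set Euclidean_space_conv_top_of_set
      using contp by (auto simp: p_def)
  qed
  have "openin (nsphere n) (g ` W')"
    unfolding eq using op1 op2 by (rule openin_Int)
  moreover have "v \<in> W'"
    using v gW k by (auto simp: W'_def H_def s_def zero_less_mult_iff not_less)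
  ultimately show "\<exists>T. openin (nsphere n) T \<and> q \<in> T \<and> T \<subseteq> g ` W"
    using v by (intro exI [of _ "g ` W'"]) (auto simp: W'_def)
qed

text \<open>The product of \<open>E\<close> with an open interval is homeomorphic to an open
  spherical shell of dimension \<open>Suc m\<close>, so invariance of domain applies. It follows
  that points of \<open>U\<close> off the rim of the collar are interior points of
  \<open>U\<close>.\<close>

lemma open_collar:
  fixes m :: nat
  defines "S \<equiv> topspace (nsphere (Suc m))" and "E \<equiv> topspace (nsphere m)"
  assumes hom: "homeomorphism U (E \<times> {-1..1::real}) \<phi> \<psi>" and US: "U \<subseteq> S"
  shows "openin (nsphere (Suc m)) (\<psi> ` (E \<times> {-1<..<1}))"
proof -
  define N where "N v = sqrt (\<Sum>j\<le>m. (v j)\<^sup>2)" for v :: "nat \<Rightarrow> real"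
  define W where "W = {v. (\<forall>i\<ge>Suc m. v i = 0) \<and> N v \<in> {1/2<..<3/2}}"
  \<comment> \<open>Polar coordinates on the spherical shell \<open>W\<close> identify it with \<open>E \<times> {-1<..<1}\<close>.\<close>
  define g where "g v = \<psi> (sphere_proj m v, 2 * (N v - 1))" for v
  have contN: "continuous_on A N" for A
    unfolding N_def
    by (intro continuous_intros continuous_on_subset [OF continuous_on_product_coordinates] subset_UNIV)
  have nz: "\<exists>i\<le>m. v i \<noteq> 0" if "N v > 0" for v
  proof (rule ccontr)
    assume "\<not> ?thesis"
    then have "N v = 0" by (auto simp: N_def intro!: sum.neutral)
    then show False using that by simp
  qed
  have Wpos: "N v > 0" if "v \<in> W" for v
    using that by (auto simp: W_def)
  have projW: "sphere_proj m v \<in> E" if "v \<in> W" for v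
    unfolding E_def using nz [OF Wpos [OF that]] that by (intro sphere_proj_in) (auto simp: W_def)
  have scale: "v = (\<lambda>i. N v * sphere_proj m v i)" if "v \<in> W" for v
    using Wpos [OF that] by (simp add: sphere_proj_def N_def [symmetric])
  have \<psi>: "continuous_on (E \<times> {-1..1}) \<psi>" "\<psi> ` (E \<times> {-1..1}) = U" "inj_on \<psi> (E \<times> {-1..1})"
    using hom by (auto simp: homeomorphism_def intro: inj_on_inverseI [of _ \<phi>])
  have im: "(\<lambda>v. (sphere_proj m v, 2 * (N v - 1))) ` W = E \<times> {-1<..<1}"
  proof (intro equalityI subsetI)
    fix z assume "z \<in> E \<times> {-1<..<1::real}"
    then obtain x t where z: "z = (x, t)" "x \<in> E" "-1 < t" "t < 1" by auto
    \<comment> \<open>The radius \<open>1 + t / 2\<close> solves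
      \<open>2 * (N v - 1) = t\<close>.\<close>
    define v where "v = (\<lambda>i. (1 + t / 2) * x i)"
    have "(\<Sum>j\<le>m. (v j)\<^sup>2) = (1 + t / 2)\<^sup>2"
      using z by (simp add: v_def power_mult_distrib E_def topspace_nsphere_iff flip: sum_distrib_left)
    then have N: "N v = 1 + t / 2"
      using z by (simp add: N_def)
    have "sphere_proj m v = x"
      using z N by (auto simp: sphere_proj_def N_def [symmetric] v_def)
    moreover have "v \<in> W"
      using z N by (auto simp: W_def v_def E_def topspace_nsphere_iff)
    ultimately show "z \<in> (\<lambda>v. (sphere_proj m v, 2 * (N v - 1))) ` W"
      using z N by (auto intro!: image_eqI [of _ _ v])
  qed (use projW in \<open>auto simp: W_def\<close>)
  have gW: "g ` W = \<psi> ` (E \<times> {-1<..<1})"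
    unfolding im [symmetric] g_def by (simp add: image_image)
  have sub: "E \<times> {-1<..<1} \<subseteq> E \<times> {-1..1::real}" by auto
  have "openin (nsphere (Suc m)) (g ` W)"
  proof (rule invariance_of_domain_nsphere)
    have "openin (top_of_set {v. \<forall>i\<ge>Suc m. v i = 0}) ({v. \<forall>i\<ge>Suc m. v i = 0} \<inter> N -` {1/2<..<3/2})"
      by (intro continuous_openin_preimage_gen contN) auto
    also have "{v. \<forall>i\<ge>Suc m. v i = 0} \<inter> N -` {1/2<..<3/2} = W"
      by (auto simp: W_def)
    finally show "openin (Euclidean_space (Suc m)) W"
      by (simp add: Euclidean_space_conv_top_of_set)
    have "continuous_on W (\<lambda>v. sphere_proj m v)"
      using nz Wpos
      by (intro continuous_on_sphere_proj continuous_on_subset [OF continuous_on_product_coordinates])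
         (auto simp: W_def)
    then have "continuous_on W (\<lambda>v. (sphere_proj m v, 2 * (N v - 1)))"
      by (intro continuous_on_Pair continuous_on_mult_left continuous_on_diff contN continuous_on_const)
    then show "continuous_on W g"
      unfolding g_def by (rule continuous_on_compose2 [OF \<psi>(1)]) (use im sub in blast)
    show "inj_on g W"
    proof (rule inj_onI)
      fix v w assume vw: "v \<in> W" "w \<in> W" "g v = g w"
      then have "(sphere_proj m v, 2 * (N v - 1)) = (sphere_proj m w, 2 * (N w - 1))"
        using inj_onD [OF \<psi>(3)] im sub unfolding g_def by blast
      then show "v = w"
        using scale [OF vw(1)] scale [OF vw(2)] by simp
    qed
    show "g ` W \<subseteq> topspace (nsphere (Suc m))"
      unfolding gW using \<psi>(2) sub US by (auto simp: S_def)
  qed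
  then show ?thesis by (simp add: gW)
qed


section \<open>Maps preserving a ring neighborhood\<close>

lemma closed_topspace_nsphere: "closed (topspace (nsphere n))"
proof -
  have "topspace (nsphere n) = {x. (\<Sum>i\<le>n. (x i)\<^sup>2) = 1} \<inter> (\<Inter>i\<in>{n<..}. {x. x i = 0})"
    by (auto simp: topspace_nsphere_iff)
  also have "closed \<dots>"
    by (intro closed_Int closed_INT ballI closed_Collect_eq continuous_intros
        continuous_on_product_coordinates)
  finally show ?thesis .
qed

text \<open>The ambient space is an infinite product of lines, so compactness comes from Tychonoff's
  theorem for the cube with sides \<open>{-1..1}\<close>.\<close>

lemma compact_topspace_nsphere: "compact (topspace (nsphere n))"
proof -
  have "compactin (powertop_real UNIV) (PiE UNIV (\<lambda>i. {-1..1}))"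
    by (simp add: compactin_PiE)
  then have "compact (PiE UNIV (\<lambda>i::nat. {-1..1::real}))"
    by (simp add: euclidean_product_topology)
  moreover have "topspace (nsphere n) \<subseteq> PiE UNIV (\<lambda>i. {-1..1})"
    using topspace_nsphere_1 [of _ n] by (fastforce simp: PiE_iff abs_le_iff abs_square_le_1)
  ultimately show ?thesis
    by (metis closed_topspace_nsphere compact_Int_closed inf.absorb_iff2)
qed

lemma same_sign_on_segment:
  fixes c :: "real \<Rightarrow> real"
  assumes "continuous_on (closed_segment a b) c" "\<And>s. s \<in> closed_segment a b \<Longrightarrow> c s \<noteq> 0"
  shows "0 < c a * c b"
proof (rule ccontr)
  assume "\<not> ?thesis"
  then have "c a \<le> 0 \<and> 0 \<le> c b \<or> c b \<le> 0 \<and> 0 \<le> c a"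
    by (auto simp: not_less mult_le_0_iff)
  moreover have "connected (c ` closed_segment a b)"
    using assms(1) by (intro connected_continuous_image connected_segment)
  ultimately have "0 \<in> c ` closed_segment a b"
    unfolding connected_iff_interval by (metis ends_in_segment imageI)
  then show False using assms(2) by auto
qed

text \<open>Squeezing \<open>f\<close> along the collar gives a homotopic map \<open>h\<close> that
  sends the equator to itself, acting there as \<open>f\<close> followed by projection to the core.
  The formula for coincidence-free maps then applies to \<open>h\<close> and \<open>y\<close>, with
  the absence of fixed points needed only on \<open>A\<close>.\<close>

lemma Brouwer_degree2_collar:
  fixes m :: nat and U :: "(nat \<Rightarrow> real) set" and f :: "(nat \<Rightarrow> real) \<Rightarrow> nat \<Rightarrow> real"
  defines "S \<equiv> topspace (nsphere (Suc m))" and "E \<equiv> topspace (nsphere m)"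
  defines "A \<equiv> nsphere (Suc m) closure_of (S - U)"
  assumes hom: "homeomorphism U (E \<times> {-1..1::real}) \<phi> \<psi>" and US: "U \<subseteq> S"
    and \<phi>E: "\<phi> ` E = E \<times> {0}" and Eint: "E \<subseteq> nsphere (Suc m) interior_of U"
    and f: "continuous_on S f" "f ` S \<subseteq> S" "f ` U \<subseteq> U"
    and nofix: "\<And>z. z \<in> A \<Longrightarrow> f z \<noteq> z"
  shows "Brouwer_degree2 (Suc m) f = - Brouwer_degree2 m (\<lambda>z. \<psi> (fst (\<phi> (f z)), 0))"
proof -
  define n where "n = Suc m"
  have c\<psi>: "continuous_on (E \<times> {-1..1}) \<psi>" and \<psi>U: "\<And>p. p \<in> E \<times> {-1..1} \<Longrightarrow> \<psi> p \<in> U"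
    and c\<phi>: "continuous_on U \<phi>" and \<phi>in: "\<And>z. z \<in> U \<Longrightarrow> \<phi> z \<in> E \<times> {-1..1}"
    and \<psi>\<phi>: "\<And>z. z \<in> U \<Longrightarrow> \<psi> (\<phi> z) = z" and \<phi>\<psi>: "\<And>p. p \<in> E \<times> {-1..1} \<Longrightarrow> \<phi> (\<psi> p) = p"
    and Ueq: "U = \<psi> ` (E \<times> {-1..1})"
    using hom by (auto simp: homeomorphism_def)
  have \<phi>1: "fst (\<phi> z) \<in> E" and \<phi>2: "snd (\<phi> z) \<in> {-1..1}" if "z \<in> U" for z
    using \<phi>in [OF that] by (auto simp: mem_Times_iff)
  have clS: "closed S" and cE: "compact E"
    by (auto simp: S_def E_def closed_topspace_nsphere compact_topspace_nsphere)
  have cU: "compact U"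
    unfolding Ueq using c\<psi> cE by (intro compact_continuous_image compact_Times) auto
  have AS: "A \<subseteq> S"
    unfolding A_def S_def by (rule closure_of_subset_topspace)
  have "closedin (nsphere n) A"
    by (simp add: A_def n_def)
  then have clA: "closed A"
    using clS by (metis S_def closedin_closed_trans n_def nsphere_eq_top_of_set)
  have cA: "compact A"
    using clA AS compact_topspace_nsphere by (metis S_def compact_Int_closed inf.absorb_iff2)
  have SA: "S - U \<subseteq> A"
    unfolding A_def S_def by (rule closure_of_subset) auto
  have int: "nsphere n interior_of U = S - A"
    by (simp add: interior_of_closure_of A_def S_def n_def)
  have EA: "E \<inter> A = {}" and EU: "E \<subseteq> U"
    using Eint int interior_of_subset [of "nsphere n" U] by (auto simp: n_def)
  have ES: "E \<subseteq> S" using EU US by auto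
  have E_iff: "z \<in> E \<longleftrightarrow> z \<in> S \<and> z n = 0" for z
    unfolding S_def E_def n_def by (rule topspace_nsphere_Suc_iff)
  have E0: "z \<in> E \<longleftrightarrow> snd (\<phi> z) = 0" if "z \<in> U" for z
  proof
    assume "z \<in> E"
    then have "\<phi> z \<in> E \<times> {0}" using \<phi>E by blast
    then show "snd (\<phi> z) = 0" by auto
  next
    assume "snd (\<phi> z) = 0"
    then have "\<phi> z \<in> \<phi> ` E"
      using \<phi>1 [OF that] \<phi>E by (simp add: mem_Times_iff)
    then obtain w where "w \<in> E" "\<phi> z = \<phi> w" by blast
    then show "z \<in> E" using that EU \<psi>\<phi> by (metis subsetD)
  qed
  have core: "\<psi> (x, 0) \<in> E" if "x \<in> E" for x
    using that E0 [of "\<psi> (x, 0)"] \<psi>U \<phi>\<psi> by simp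
  \<comment> \<open>By invariance of domain, a collar coordinate strictly between -1 and 1 would
    make \<open>z\<close> an interior point of \<open>U\<close>, which \<open>A\<close>
    excludes.\<close>
  have rim: "\<bar>snd (\<phi> z)\<bar> = 1" if "z \<in> A" "z \<in> U" for z
  proof (rule ccontr)
    assume "\<not> ?thesis"
    then have "z \<in> \<psi> ` (E \<times> {-1<..<1})"
      using \<phi>1 [OF that(2)] \<phi>2 [OF that(2)] \<psi>\<phi> [OF that(2)]
      by (intro image_eqI [of _ _ "\<phi> z"]) (auto simp: mem_Times_iff)
    moreover have "\<psi> ` (E \<times> {-1<..<1}) \<subseteq> nsphere n interior_of U"
      using open_collar [of U m \<phi> \<psi>] hom US \<psi>U
      by (intro interior_of_maximal) (auto simp: S_def E_def n_def)
    ultimately show False using int that by auto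
  qed
  \<comment> \<open>\<open>l\<close> is the factor left on the collar coordinate after squeezing: 0
    on the equator, 1 on \<open>A\<close> and strictly below 1 elsewhere.\<close>
  obtain l :: "(nat \<Rightarrow> real) \<Rightarrow> real" where l: "continuous_on UNIV l" "\<And>z. 0 \<le> l z" "\<And>z. l z \<le> 1"
    "\<And>z. z \<in> E \<Longrightarrow> l z = 0" "\<And>z. l z = 1 \<longleftrightarrow> z \<in> A"
  \<comment> \<open>The distance \<open>infdist\<close> to the empty set is 0 by convention, so the
    quotient of distances would be 1 off the equator; the constant 0 replaces it.\<close>
  proof (cases "A = {}")
    case True
    then show ?thesis by (intro that [of "\<lambda>z. 0"]) auto
  next
    case False
    have clE: "closed E" and Ene: "E \<noteq> {}"
      using cE compact_imp_closed in_topspace_nsphere by (auto simp: E_def)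
    have pos: "0 < infdist z E + infdist z A" for z
      using in_closed_iff_infdist_zero [OF clE Ene, of z] in_closed_iff_infdist_zero [OF clA False, of z]
        infdist_nonneg [of z E] infdist_nonneg [of z A] EA by (cases "z \<in> E") (auto simp: order_less_le)
    show ?thesis
    proof (rule that [of "\<lambda>z. infdist z E / (infdist z E + infdist z A)"])
      show "continuous_on UNIV (\<lambda>z. infdist z E / (infdist z E + infdist z A))"
        using pos by (intro continuous_intros) (simp add: less_imp_neq [symmetric])
      show "0 \<le> infdist z E / (infdist z E + infdist z A)" "infdist z E / (infdist z E + infdist z A) \<le> 1" for z
        using pos [of z] infdist_nonneg [of z A] infdist_nonneg [of z E] by auto
      show "infdist z E / (infdist z E + infdist z A) = 0" if "z \<in> E" for z
        using that by simp
      show "infdist z E / (infdist z E + infdist z A) = 1 \<longleftrightarrow> z \<in> A" for z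
        using pos [of z] in_closed_iff_infdist_zero [OF clA False, of z] by (auto simp: divide_eq_1_iff)
    qed
  qed
  \<comment> \<open>The scaling factor of the collar coordinate of \<open>f z\<close> runs from 1 to
    \<open>l z\<close>. On \<open>U \<inter> A\<close> it stays 1, so the two branches agree
    there.\<close>
  define G where "G = (\<lambda>(s, z). if z \<in> U then \<psi> (fst (\<phi> (f z)), (1 - s + s * l z) * snd (\<phi> (f z))) else f z)"
  define h where "h z = G (1, z)" for z
  \<comment> \<open>On \<open>U \<inter> A\<close> the collar coordinate is already 1 or -1, so
    \<open>y\<close> is the identity there and the branches fit together.\<close>
  define y where "y z = (if z \<in> U then \<psi> (fst (\<phi> z), sgn (snd (\<phi> z))) else z)" for z
  have S_eq: "S = U \<union> A" using SA US AS by auto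
  have par: "(1 - s + s * l z) * t \<in> {-1..1}" if "s \<in> {0..1}" "t \<in> {-1..1}" for s z t
  proof -
    have "0 \<le> 1 - s + s * l z" "1 - s + s * l z \<le> 1"
      using that l(2,3) [of z] mult_left_le [of "l z" s] by auto
    then have "\<bar>(1 - s + s * l z) * t\<bar> \<le> 1 * 1"
      unfolding abs_mult using that by (intro mult_mono) auto
    then show ?thesis by (auto simp: abs_le_iff)
  qed
  have fU: "f z \<in> U" if "z \<in> U" for z using f(3) that by blast
  have contG: "continuous_on ({0..1} \<times> S) G"
  proof -
    have cf: "continuous_on ({0..1} \<times> U) (\<lambda>p. \<phi> (f (snd p)))"
      by (rule continuous_on_compose2 [OF c\<phi>], rule continuous_on_compose2 [OF f(1)])
         (use US fU in \<open>auto intro: continuous_intros\<close>)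
    have cl: "continuous_on ({0..1::real} \<times> U) (\<lambda>p. l (snd p))"
      by (rule continuous_on_compose2 [OF l(1)]) (auto intro: continuous_intros)
    have "continuous_on ({0..1} \<times> U) (\<lambda>p. \<psi> (fst (\<phi> (f (snd p))), (1 - fst p + fst p * l (snd p)) * snd (\<phi> (f (snd p)))))"
    proof (rule continuous_on_compose2 [OF c\<psi>])
      show "continuous_on ({0..1} \<times> U) (\<lambda>p. (fst (\<phi> (f (snd p))), (1 - fst p + fst p * l (snd p)) * snd (\<phi> (f (snd p)))))"
        by (intro continuous_on_Pair continuous_on_mult continuous_on_add continuous_on_diff
            continuous_on_const continuous_on_fst continuous_on_snd continuous_on_id cf cl)
    qed (use \<phi>1 \<phi>2 fU par in auto)
    moreover have "continuous_on ({0..1} \<times> A) (\<lambda>p. f (snd p))"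
      by (rule continuous_on_compose2 [OF f(1)]) (use AS in \<open>auto intro: continuous_intros\<close>)
    moreover have "closed ({0..1::real} \<times> U)" "closed ({0..1::real} \<times> A)"
      using compact_imp_closed [OF cU] clA by (auto intro!: closed_Times)
    moreover have "\<psi> (fst (\<phi> (f z)), (1 - s + s * l z) * snd (\<phi> (f z))) = f z" if "z \<in> A" "z \<in> U" for s z
      using that l(5) [of z] \<psi>\<phi> fU by simp
    ultimately have "continuous_on ({0..1} \<times> U \<union> {0..1} \<times> A)
        (\<lambda>p. if snd p \<in> U then \<psi> (fst (\<phi> (f (snd p))), (1 - fst p + fst p * l (snd p)) * snd (\<phi> (f (snd p)))) else f (snd p))"
      by (intro continuous_on_cases) auto
    moreover have "{0..1::real} \<times> U \<union> {0..1} \<times> A = {0..1} \<times> S"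
      using S_eq by auto
    ultimately show ?thesis
      by (simp add: G_def case_prod_unfold)
  qed
  have GS: "G (s, z) \<in> S" if "s \<in> {0..1}" "z \<in> S" for s z
  proof (cases "z \<in> U")
    case True
    then show ?thesis
      using \<phi>1 fU par [OF that(1) \<phi>2 [OF fU [OF True]], of z] by (auto simp: G_def intro!: subsetD [OF US] \<psi>U)
  next
    case False
    then show ?thesis
      using that f(2) by (auto simp: G_def)
  qed
  have "homotopic_with (\<lambda>x. True) (nsphere n) (nsphere n) (\<lambda>z. G (0, z)) (\<lambda>z. G (1, z))"
    by (rule homotopic_nsphere) (use contG GS in \<open>simp_all add: S_def n_def\<close>)
  then have "Brouwer_degree2 n (\<lambda>z. G (0, z)) = Brouwer_degree2 n h"
    by (simp add: h_def [abs_def] Brouwer_degree2_homotopic)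
  moreover have "G (0, z) = f z" for z
    using \<psi>\<phi> fU by (simp add: G_def)
  ultimately have deg: "Brouwer_degree2 n f = Brouwer_degree2 n h"
    by simp
  have hU: "h z = \<psi> (fst (\<phi> (f z)), l z * snd (\<phi> (f z)))" if "z \<in> U" for z
    using that by (simp add: h_def G_def)
  have hE: "h z = \<psi> (fst (\<phi> (f z)), 0)" if "z \<in> E" for z
    using that EU l(4) hU by (auto simp: subset_iff)
  have hA: "h z = f z" if "z \<in> A" for z
    using that l(5) [of z] \<psi>\<phi> fU by (simp add: h_def G_def)
  have sgn1: "sgn t \<in> {-1..1}" for t :: real
    by (simp add: sgn_if)
  have yA: "y z = z" if "z \<in> A" for z
  proof (cases "z \<in> U")
    case True
    then have "sgn (snd (\<phi> z)) = snd (\<phi> z)"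
      using rim [OF that True] by (auto simp: sgn_if abs_if split: if_splits)
    then show ?thesis using True \<psi>\<phi> by (simp add: y_def)
  qed (simp add: y_def)
  \<comment> \<open>A compact set that contains all values of \<open>y\<close> and misses the
    equator; the minimum of \<open>\<bar>z n\<bar>\<close> on it is the height bound for
    \<open>y\<close>.\<close>
  define K where "K = \<psi> ` (E \<times> {-1, 1}) \<union> A"
  have cK: "compact K"
    unfolding K_def using cE cA
    by (intro compact_Un compact_continuous_image continuous_on_subset [OF c\<psi>] compact_Times) auto
  have yK: "y z \<in> K" if "z \<in> S - E" for z
  proof (cases "z \<in> U")
    case True
    then have "sgn (snd (\<phi> z)) \<in> {-1, 1}" using E0 that by (auto simp: sgn_if)
    then show ?thesis using True \<phi>1 by (auto simp: K_def y_def)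
  next
    case False
    then show ?thesis using that SA by (auto simp: K_def y_def)
  qed
  have KS: "K \<subseteq> S - E"
  proof -
    have "\<psi> (x, t) \<in> S - E" if "x \<in> E" "t \<in> {-1, 1}" for x t
      using that \<psi>U [of "(x, t)"] US \<phi>\<psi> [of "(x, t)"] E0 [of "\<psi> (x, t)"] by auto
    then show ?thesis using AS EA by (auto simp: K_def)
  qed
  obtain x0 where x0: "x0 \<in> K" "\<And>z. z \<in> K \<Longrightarrow> \<bar>x0 n\<bar> \<le> \<bar>z n\<bar>"
  proof -
    have "E \<noteq> {}" using in_topspace_nsphere by (auto simp: E_def)
    then have "K \<noteq> {}" by (auto simp: K_def)
    moreover have "continuous_on K (\<lambda>z. \<bar>z n\<bar>)"
      by (intro continuous_on_rabs continuous_on_subset [OF continuous_on_product_coordinates]) auto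
    ultimately show ?thesis
      using continuous_attains_inf [OF cK] that by blast
  qed
  have "Brouwer_degree2 n h = - Brouwer_degree2 m h"
  proof (rule Brouwer_degree2_coincidence_free [of m h y "\<bar>x0 n\<bar>", folded S_def E_def n_def])
    show "continuous_on S h"
      unfolding h_def by (rule continuous_on_compose2 [OF contG]) (auto intro!: continuous_intros)
    show "h ` S \<subseteq> S"
      using GS by (auto simp: h_def)
    show "h ` E \<subseteq> E"
      using hE core \<phi>1 fU EU by (auto simp: subset_iff)
    show "y ` (S - E) \<subseteq> S"
      using yK KS by blast
    show "\<bar>x0 n\<bar> > 0"
      using x0(1) KS E_iff by auto
    show "\<bar>x0 n\<bar> \<le> \<bar>y z n\<bar>" if "z \<in> S - E" for z
      using x0(2) yK that by blast
    show "continuous_on (S - E) y"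
    proof -
      have "continuous_on (U - E) (\<lambda>z. \<psi> (fst (\<phi> z), sgn (snd (\<phi> z))))"
      proof (rule continuous_on_compose2 [OF c\<psi>])
        have c: "continuous_on (U - E) \<phi>"
          using c\<phi> by (rule continuous_on_subset) auto
        show "continuous_on (U - E) (\<lambda>z. (fst (\<phi> z), sgn (snd (\<phi> z))))"
          using E0 by (intro continuous_on_Pair continuous_on_sgn continuous_on_fst continuous_on_snd c) auto
      qed (use \<phi>1 sgn1 in auto)
      moreover have "(U - E) \<union> A = S - E" using S_eq EA by auto
      moreover have "closedin (top_of_set (S - E)) (U - E)"
        using compact_imp_closed [OF cU] US by (auto simp: closedin_closed intro!: exI [of _ U])
      moreover have "closedin (top_of_set (S - E)) A"
        using clA AS EA by (auto simp: closedin_closed intro!: exI [of _ A])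
      moreover have "\<psi> (fst (\<phi> z), sgn (snd (\<phi> z))) = z" if "z \<in> A" "z \<in> U" for z
        using yA [OF that(1)] that(2) by (simp add: y_def)
      ultimately have "continuous_on ((U - E) \<union> A) (\<lambda>z. if z \<in> U then \<psi> (fst (\<phi> z), sgn (snd (\<phi> z))) else z)"
        by (intro continuous_on_cases_local) (auto intro: continuous_intros)
      then show ?thesis
        using \<open>(U - E) \<union> A = S - E\<close> by (simp add: y_def [abs_def])
    qed
    \<comment> \<open>\<open>y\<close> moves \<open>z\<close> along a collar fibre. Only collar
      coordinate 0 gives points of the equator, so the last coordinate never vanishes on the way and
      keeps its sign.\<close>
    show "0 < y z n * z n" if z: "z \<in> S - E" for z
    proof (cases "z \<in> U")
      case False
      then show ?thesis using z E_iff by (auto simp: y_def simp flip: power2_eq_square)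
    next
      case True
      define x t where "x = fst (\<phi> z)" and "t = snd (\<phi> z)"
      have x: "x \<in> E" "t \<in> {-1..1}" "t \<noteq> 0"
        using \<phi>1 \<phi>2 E0 True z by (auto simp: x_def t_def)
      have seg: "s \<in> {-1..1}" "s \<noteq> 0" if "s \<in> closed_segment (sgn t) t" for s
        using that x by (auto simp: closed_segment_eq_real_ivl sgn_if split: if_splits)
      have "0 < \<psi> (x, sgn t) n * \<psi> (x, t) n"
      proof (rule same_sign_on_segment [of "sgn t" t "\<lambda>s. \<psi> (x, s) n"])
        have "continuous_on (closed_segment (sgn t) t) (\<lambda>s. \<psi> (x, s))"
          by (rule continuous_on_compose2 [OF c\<psi>])
             (use seg x in \<open>auto intro!: continuous_on_Pair continuous_on_const continuous_on_id\<close>)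
        then show "continuous_on (closed_segment (sgn t) t) (\<lambda>s. \<psi> (x, s) n)"
          by (rule continuous_on_coord)
        show "\<psi> (x, s) n \<noteq> 0" if "s \<in> closed_segment (sgn t) t" for s
          using seg [OF that] x \<psi>U [of "(x, s)"] \<phi>\<psi> [of "(x, s)"] US E0 [of "\<psi> (x, s)"] E_iff [of "\<psi> (x, s)"] by auto
      qed
      moreover have "\<psi> (x, t) = z"
        using \<psi>\<phi> [OF True] by (simp add: x_def t_def)
      ultimately show ?thesis
        using True by (simp add: y_def x_def t_def)
    qed
    show "h z \<noteq> y z" if z: "z \<in> S - E" for z
    proof (cases "z \<in> A")
      case True
      then show ?thesis using hA yA nofix by simp
    next
      case False
      \<comment> \<open>Off \<open>A\<close>, \<open>l z < 1\<close> keeps the collar coordinate of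
        \<open>h z\<close> strictly between -1 and 1, while that of \<open>y z\<close> is 1 or
        -1.\<close>
      then have zU: "z \<in> U" using z SA by auto
      show ?thesis
      proof
        assume eq: "h z = y z"
        define s where "s = l z * snd (\<phi> (f z))"
        have s: "s \<in> {-1..1}"
          using par [of 1 "snd (\<phi> (f z))" z] \<phi>2 [OF fU [OF zU]] by (simp add: s_def)
        have "(fst (\<phi> (f z)), s) = (fst (\<phi> z), sgn (snd (\<phi> z)))"
          using eq hU [OF zU] \<phi>\<psi> \<phi>1 [OF fU [OF zU]] \<phi>1 [OF zU] s sgn1 zU
          by (metis (no_types, lifting) SigmaI s_def y_def)
        then have "\<bar>s\<bar> = 1" using E0 [OF zU] z by (auto simp: sgn_if)
        moreover have "\<bar>s\<bar> \<le> l z"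
          unfolding s_def abs_mult using l(2) [of z] \<phi>2 [OF fU [OF zU]] by (auto simp: abs_le_iff intro!: mult_left_le)
        ultimately have "l z = 1" using l(3) [of z] by simp
        then show False using l(5) False by blast
      qed
    qed
  qed
  moreover have "Brouwer_degree2 m h = Brouwer_degree2 m (\<lambda>z. \<psi> (fst (\<phi> (f z)), 0))"
    by (rule Brouwer_degree2_eq) (simp add: hE E_def)
  ultimately show ?thesis
    using deg by (simp add: n_def)
qed


section \<open>The induced map on integral homology\<close>

text \<open>A chase in the exact sequence of the pair: the first application of \<open>f\<close>
  kills the boundary, so the class comes from the absolute homology of \<open>X\<close>, where the
  second application kills it.\<close>

lemma hom_induced_square_trivial:
  fixes p :: int
  assumes f: "continuous_map X X f" "f \<in> U \<rightarrow> U"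
    and X: "\<And>e. e \<in> carrier (homology_group p X) \<Longrightarrow>
      hom_induced p X {} X {} f e = \<one>\<^bsub>homology_group p X\<^esub>"
    and U: "\<And>e. e \<in> carrier (reduced_homology_group (p - 1) (subtopology X U)) \<Longrightarrow>
      hom_induced (p - 1) (subtopology X U) {} (subtopology X U) {} f e
        = \<one>\<^bsub>homology_group (p - 1) (subtopology X U)\<^esub>"
    and z: "z \<in> carrier (relative_homology_group p X U)"
  shows "hom_induced p X U X U f (hom_induced p X U X U f z) = \<one>\<^bsub>relative_homology_group p X U\<^esub>"
proof -
  define w where "w = hom_induced p X U X U f z"
  have w: "w \<in> carrier (relative_homology_group p X U)"
    by (simp add: w_def hom_induced_carrier)
  let ?j = "hom_induced p X {} X U id"
  have "hom_boundary p X U w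
      = hom_induced (p - 1) (subtopology X U) {} (subtopology X U) {} f (hom_boundary p X U z)"
    using naturality_hom_induced [OF f, of p] by (metis comp_apply w_def)
  \<comment> \<open>Boundaries are reduced classes, which matters for \<open>p = 1\<close>, where
    \<open>f\<close> need not kill all of the homology of \<open>U\<close> in degree 0.\<close>
  also have "\<dots> = \<one>\<^bsub>homology_group (p - 1) (subtopology X U)\<^esub>"
    using hom_boundary_reduced_hom z by (intro U) (rule hom_in_carrier)
  finally have "w \<in> kernel (relative_homology_group p X U) (homology_group (p - 1) (subtopology X U)) (hom_boundary p X U)"
    using w by (simp add: kernel_def)
  then have "w \<in> ?j ` carrier (homology_group p X)"
    using homology_exactness_axiom_1 [of p X U] by simp
  then obtain e where e: "e \<in> carrier (homology_group p X)" "w = ?j e"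
    by blast
  have "hom_induced p X U X U f w = hom_induced p X {} X U (f \<circ> id) e"
    unfolding e(2) by (rule hom_induced_compose') (use f in auto)
  also have "\<dots> = hom_induced p X {} X U (id \<circ> f) e"
    by simp
  also have "\<dots> = ?j (hom_induced p X {} X {} f e)"
    by (rule hom_induced_compose' [symmetric]) (use f in auto)
  also have "\<dots> = \<one>\<^bsub>relative_homology_group p X U\<^esub>"
    unfolding X [OF e(1)] by (rule hom_one [OF hom_induced_hom]) auto
  finally show ?thesis by (simp add: w_def)
qed

section \<open>Deformation of the ring onto the equator\<close>

definition squeeze ::
    "('a \<Rightarrow> 'b \<times> real) \<Rightarrow> ('b \<times> real \<Rightarrow> 'c) \<Rightarrow> real \<times> 'a \<Rightarrow> 'c"
  where "squeeze \<phi> \<psi> = (\<lambda>(s, z). \<psi> (fst (\<phi> z), s * snd (\<phi> z)))"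

context
  fixes m :: nat and U :: "(nat \<Rightarrow> real) set" and \<phi> \<psi> and f :: "(nat \<Rightarrow> real) \<Rightarrow> nat \<Rightarrow> real"
  assumes hom: "homeomorphism U (topspace (nsphere m) \<times> {-1..1::real}) \<phi> \<psi>"
    and US: "U \<subseteq> topspace (nsphere (Suc m))"
    and EU: "topspace (nsphere m) \<subseteq> U"
    and \<phi>E: "\<phi> ` topspace (nsphere m) = topspace (nsphere m) \<times> {0}"
    and f: "continuous_on U f" "f ` U \<subseteq> U"
begin

lemma squeeze_facts:
  shows continuous_on_squeeze: "continuous_on ({0..1} \<times> U) (squeeze \<phi> \<psi>)"
    and squeeze_in: "\<And>s z. s \<in> {0..1} \<Longrightarrow> z \<in> U \<Longrightarrow> squeeze \<phi> \<psi> (s, z) \<in> U"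
    and squeeze_1: "\<And>z. z \<in> U \<Longrightarrow> squeeze \<phi> \<psi> (1, z) = z"
    and squeeze_0_in: "\<And>z. z \<in> U \<Longrightarrow> squeeze \<phi> \<psi> (0, z) \<in> topspace (nsphere m)"
proof -
  let ?E = "topspace (nsphere m)"
  have c\<psi>: "continuous_on (?E \<times> {-1..1}) \<psi>" and \<psi>U: "\<And>p. p \<in> ?E \<times> {-1..1} \<Longrightarrow> \<psi> p \<in> U"
    and c\<phi>: "continuous_on U \<phi>" and \<phi>in: "\<And>z. z \<in> U \<Longrightarrow> \<phi> z \<in> ?E \<times> {-1..1}"
    and \<psi>\<phi>: "\<And>z. z \<in> U \<Longrightarrow> \<psi> (\<phi> z) = z"
    using hom by (auto simp: homeomorphism_def)
  have par: "(fst (\<phi> z), s * snd (\<phi> z)) \<in> ?E \<times> {-1..1}" if "s \<in> {0..1}" "z \<in> U" for s z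
  proof -
    have "\<bar>s * snd (\<phi> z)\<bar> \<le> 1 * 1"
      unfolding abs_mult using that \<phi>in [OF that(2)] by (intro mult_mono) (auto simp: mem_Times_iff abs_le_iff)
    then show ?thesis using \<phi>in [OF that(2)] by (auto simp: mem_Times_iff abs_le_iff)
  qed
  have "continuous_on ({0..1::real} \<times> U) (\<lambda>p. \<phi> (snd p))"
    by (rule continuous_on_compose2 [OF c\<phi>]) (auto intro: continuous_intros)
  then have "continuous_on ({0..1} \<times> U) (\<lambda>p. (fst (\<phi> (snd p)), fst p * snd (\<phi> (snd p))))"
    by (intro continuous_on_Pair continuous_on_mult continuous_on_fst continuous_on_snd continuous_on_id)
  then show "continuous_on ({0..1} \<times> U) (squeeze \<phi> \<psi>)"
    unfolding squeeze_def case_prod_unfold by (rule continuous_on_compose2 [OF c\<psi>]) (use par in auto)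
  show "squeeze \<phi> \<psi> (s, z) \<in> U" if "s \<in> {0..1}" "z \<in> U" for s z
    using par [OF that] \<psi>U by (simp add: squeeze_def)
  show "squeeze \<phi> \<psi> (1, z) = z" if "z \<in> U" for z
    using \<psi>\<phi> that by (simp add: squeeze_def)
  show "squeeze \<phi> \<psi> (0, z) \<in> topspace (nsphere m)" if z: "z \<in> U" for z
  proof -
    have "(fst (\<phi> z), 0) \<in> \<phi> ` ?E"
      using \<phi>in [OF z] \<phi>E by (auto simp: mem_Times_iff)
    then show ?thesis
      using \<psi>\<phi> EU by (force simp: squeeze_def)
  qed
qed

lemma continuous_on_squeeze_0: "continuous_on U (\<lambda>z. squeeze \<phi> \<psi> (0, z))"
  by (rule continuous_on_compose2 [OF continuous_on_squeeze]) (auto intro!: continuous_on_Pair continuous_on_const continuous_on_id)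

text \<open>A squeeze inserted between the two applications of \<open>f\<close> is the identity at
  parameter 1; at parameter 0 it makes the map the square of \<open>f\<close> followed by the
  retraction.\<close>

lemma Brouwer_degree2_core_compose:
  "Brouwer_degree2 m (\<lambda>z. squeeze \<phi> \<psi> (0, f (f z))) = (Brouwer_degree2 m (\<lambda>z. squeeze \<phi> \<psi> (0, f z)))\<^sup>2"
proof -
  let ?E = "topspace (nsphere m)"
  define H where "H = (\<lambda>p. squeeze \<phi> \<psi> (0, f (squeeze \<phi> \<psi> (fst p, f (snd p)))))"
  have fU: "f z \<in> U" if "z \<in> U" for z using f(2) that by blast
  have fc: "continuous_on ({0..1::real} \<times> ?E) (\<lambda>p. f (snd p))"
    by (rule continuous_on_compose2 [OF f(1)]) (use EU in \<open>auto intro: continuous_intros\<close>)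
  have "continuous_on ({0..1} \<times> ?E) (\<lambda>p. squeeze \<phi> \<psi> (fst p, f (snd p)))"
    by (rule continuous_on_compose2 [OF continuous_on_squeeze])
       (use fU EU fc in \<open>auto intro!: continuous_on_Pair continuous_on_fst continuous_on_id\<close>)
  then have "continuous_on ({0..1} \<times> ?E) (\<lambda>p. f (squeeze \<phi> \<psi> (fst p, f (snd p))))"
    by (rule continuous_on_compose2 [OF f(1)]) (use fU EU squeeze_in in auto)
  then have "continuous_on ({0..1} \<times> ?E) H"
    unfolding H_def by (rule continuous_on_compose2 [OF continuous_on_squeeze_0]) (use fU EU squeeze_in in auto)
  then have "homotopic_with (\<lambda>x. True) (nsphere m) (nsphere m) (\<lambda>z. H (0, z)) (\<lambda>z. H (1, z))"
    by (rule homotopic_nsphere) (use fU EU squeeze_in squeeze_0_in in \<open>auto simp: H_def\<close>)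
  then have "Brouwer_degree2 m (\<lambda>z. H (1, z)) = Brouwer_degree2 m (\<lambda>z. H (0, z))"
    by (simp add: Brouwer_degree2_homotopic)
  also have "(\<lambda>z. H (0, z)) = (\<lambda>z. squeeze \<phi> \<psi> (0, f z)) \<circ> (\<lambda>z. squeeze \<phi> \<psi> (0, f z))"
    by (simp add: H_def fun_eq_iff)
  also have "Brouwer_degree2 m \<dots> = (Brouwer_degree2 m (\<lambda>z. squeeze \<phi> \<psi> (0, f z)))\<^sup>2"
  proof -
    have "continuous_on ?E (\<lambda>z. squeeze \<phi> \<psi> (0, f z))"
      by (rule continuous_on_compose2 [OF continuous_on_squeeze_0 continuous_on_subset [OF f(1) EU]])
         (use fU EU in auto)
    then have c: "continuous_map (nsphere m) (nsphere m) (\<lambda>z. squeeze \<phi> \<psi> (0, f z))"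
      using fU EU squeeze_0_in by (auto simp: continuous_map_nsphere_iff)
    show ?thesis
      unfolding power2_eq_square by (rule Brouwer_degree2_compose [OF c c])
  qed
  also have "Brouwer_degree2 m (\<lambda>z. H (1, z)) = Brouwer_degree2 m (\<lambda>z. squeeze \<phi> \<psi> (0, f (f z)))"
    by (rule Brouwer_degree2_eq) (use fU EU squeeze_1 in \<open>auto simp: H_def\<close>)
  finally show ?thesis .
qed

text \<open>Squeezing both before and after \<open>f\<close> deforms it on \<open>U\<close> to a map
  that factors through the degree 0 self-map \<open>q\<close> of \<open>nsphere m\<close>, which
  kills reduced classes.\<close>

lemma hom_induced_ring_trivial:
  assumes deg: "Brouwer_degree2 m (\<lambda>z. squeeze \<phi> \<psi> (0, f z)) = 0"
    and e: "e \<in> carrier (reduced_homology_group (int m) (top_of_set U))"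
  shows "hom_induced (int m) (top_of_set U) {} (top_of_set U) {} f e
    = \<one>\<^bsub>homology_group (int m) (top_of_set U)\<^esub>"
proof -
  let ?E = "topspace (nsphere m)"
  define q where "q = (\<lambda>z. squeeze \<phi> \<psi> (0, f z))"
  define r where "r = (\<lambda>z. squeeze \<phi> \<psi> (0, z))"
  have fU: "f z \<in> U" if "z \<in> U" for z using f(2) that by blast
  define H where "H = (\<lambda>p. squeeze \<phi> \<psi> (fst p, f (squeeze \<phi> \<psi> p)))"
  have "continuous_on ({0..1} \<times> U) (\<lambda>p. f (squeeze \<phi> \<psi> p))"
    by (rule continuous_on_compose2 [OF f(1) continuous_on_squeeze]) (use squeeze_in in auto)
  then have "continuous_on ({0..1} \<times> U) H"
    unfolding H_def
    by (intro continuous_on_compose2 [OF continuous_on_squeeze] continuous_on_Pair continuous_on_fst continuous_on_id)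
       (use fU squeeze_in in auto)
  then have "continuous_map (prod_topology (top_of_set {0..1}) (top_of_set U)) (top_of_set U) H"
    using squeeze_in fU by (auto simp: H_def simp flip: subtopology_Times)
  then have "homotopic_with (\<lambda>x. True) (top_of_set U) (top_of_set U) (\<lambda>z. H (0, z)) (\<lambda>z. H (1, z))"
    unfolding homotopic_with_def by - (rule exI [of _ H], simp)
  then have "hom_induced (int m) (top_of_set U) {} (top_of_set U) {} (\<lambda>z. H (0, z))
      = hom_induced (int m) (top_of_set U) {} (top_of_set U) {} (\<lambda>z. H (1, z))"
    by (rule homology_homotopy_empty)
  also have "\<dots> = hom_induced (int m) (top_of_set U) {} (top_of_set U) {} f"
    by (rule hom_induced_eq) (use fU squeeze_1 in \<open>simp add: H_def\<close>)
  finally have "hom_induced (int m) (top_of_set U) {} (top_of_set U) {} f e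
      = hom_induced (int m) (top_of_set U) {} (top_of_set U) {} (id \<circ> (q \<circ> r)) e"
    by (simp add: H_def q_def r_def o_def)
  have cr: "continuous_map (top_of_set U) (nsphere m) r"
    using continuous_on_squeeze_0 squeeze_0_in by (subst nsphere_eq_top_of_set) (auto simp: r_def)
  have "continuous_on ?E q"
    unfolding q_def
    by (rule continuous_on_compose2 [OF continuous_on_squeeze_0 continuous_on_subset [OF f(1) EU]])
       (use fU EU in auto)
  then have cq: "continuous_map (nsphere m) (nsphere m) q"
    using fU EU squeeze_0_in by (auto simp: continuous_map_nsphere_iff q_def)
  have ci: "continuous_map (nsphere m) (top_of_set U) id"
    using EU by (subst nsphere_eq_top_of_set) auto
  let ?R = "reduced_homology_group (int m) (nsphere m)"
  define x where "x = hom_induced (int m) (top_of_set U) {} (nsphere m) {} r e"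
  have x: "x \<in> carrier ?R"
    unfolding x_def using e by (rule hom_induced_reduced)
  have "hom_induced (int m) (top_of_set U) {} (top_of_set U) {} (id \<circ> (q \<circ> r)) e
      = hom_induced (int m) (nsphere m) {} (top_of_set U) {} id
          (hom_induced (int m) (nsphere m) {} (nsphere m) {} q x)"
    using cr cq ci by (simp add: hom_induced_compose_empty [of _ "nsphere m"] continuous_map_compose x_def del: id_comp comp_id)
  also have "hom_induced (int m) (nsphere m) {} (nsphere m) {} q x = \<one>\<^bsub>homology_group (int m) (nsphere m)\<^esub>"
    using Brouwer_degree2 [OF x, of q] deg by (simp add: q_def one_reduced_homology_group)
  also have "hom_induced (int m) (nsphere m) {} (top_of_set U) {} id \<dots> = \<one>\<^bsub>homology_group (int m) (top_of_set U)\<^esub>"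
    by (rule hom_one [OF hom_induced_hom]) auto
  finally show ?thesis
    using \<open>hom_induced (int m) (top_of_set U) {} (top_of_set U) {} f e = _\<close> by (simp add: o_def)
qed

end

text \<open>Vanishing of both degrees makes the induced map square to zero. The conclusion is stated
  for chains, because rational and integral homology are compared at that level.\<close>

lemma chain_map_square_relboundary:
  fixes m :: nat and U :: "(nat \<Rightarrow> real) set" and f :: "(nat \<Rightarrow> real) \<Rightarrow> nat \<Rightarrow> real"
  assumes hom: "homeomorphism U (topspace (nsphere m) \<times> {-1..1::real}) \<phi> \<psi>"
    and US: "U \<subseteq> topspace (nsphere (Suc m))"
    and \<phi>E: "\<phi> ` topspace (nsphere m) = topspace (nsphere m) \<times> {0}"
    and Eint: "topspace (nsphere m) \<subseteq> nsphere (Suc m) interior_of U"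
    and f: "continuous_map (nsphere (Suc m)) (nsphere (Suc m)) f" "f ` U \<subseteq> U"
    and nofix: "\<And>z. z \<in> nsphere (Suc m) closure_of (topspace (nsphere (Suc m)) - U) \<Longrightarrow> f z \<noteq> z \<and> f (f z) \<noteq> z"
    and c: "singular_relcycle (Suc m) (nsphere (Suc m)) U c"
  shows "singular_relboundary (Suc m) (nsphere (Suc m)) U (chain_map (Suc m) f (chain_map (Suc m) f c))"
proof -
  let ?X = "nsphere (Suc m)" and ?S = "topspace (nsphere (Suc m))"
  have EU: "topspace (nsphere m) \<subseteq> U"
    using Eint interior_of_subset [of ?X U] by simp
  have fS: "continuous_on ?S f" "f ` ?S \<subseteq> ?S"
    using f(1) by (auto simp: continuous_map_nsphere_iff)
  have "f z \<in> ?S" if "z \<in> ?S" for z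
    using fS(2) that by blast
  moreover have "f z \<in> U" if "z \<in> U" for z
    using f(2) that by blast
  ultimately have ffS: "(f \<circ> f) ` ?S \<subseteq> ?S" "(f \<circ> f) ` U \<subseteq> U"
    by auto
  have cff: "continuous_on ?S (f \<circ> f)"
    using continuous_on_compose [OF fS(1) continuous_on_subset [OF fS]] .
  have fU: "continuous_on U f"
    using fS(1) US by (rule continuous_on_subset)
  let ?r = "\<lambda>z. squeeze \<phi> \<psi> (0, z)"
  have r: "?r z = \<psi> (fst (\<phi> z), 0)" for z
    by (simp add: squeeze_def)
  define \<delta> where "\<delta> = Brouwer_degree2 (Suc m) f"
  define \<gamma> where "\<gamma> = Brouwer_degree2 m (\<lambda>z. ?r (f z))"
  have 1: "\<delta> = - \<gamma>"
    unfolding \<delta>_def \<gamma>_def r using nofix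
    by (intro Brouwer_degree2_collar [OF hom US \<phi>E Eint fS f(2)]) blast
  \<comment> \<open>\<open>f \<circ> f\<close> also preserves \<open>U\<close>, and it has no fixed
    points in the closure since \<open>f\<close> has no points of period 2 there.\<close>
  have "Brouwer_degree2 (Suc m) (f \<circ> f) = - Brouwer_degree2 m (\<lambda>z. ?r ((f \<circ> f) z))"
    unfolding r using nofix
    by (intro Brouwer_degree2_collar [OF hom US \<phi>E Eint cff ffS]) simp
  moreover have "Brouwer_degree2 m (\<lambda>z. ?r ((f \<circ> f) z)) = \<gamma>\<^sup>2"
    using Brouwer_degree2_core_compose [OF hom US EU \<phi>E fU f(2)] by (simp add: \<gamma>_def)
  moreover have "Brouwer_degree2 (Suc m) (f \<circ> f) = \<delta>\<^sup>2"
    using Brouwer_degree2_compose [OF f(1) f(1)] by (simp add: \<delta>_def power2_eq_square)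
  \<comment> \<open>From \<open>\<delta> = - \<gamma>\<close> and
    \<open>\<delta>\<^sup>2 = - \<gamma>\<^sup>2\<close> it follows that
    \<open>\<gamma>\<^sup>2 = - \<gamma>\<^sup>2\<close>.\<close>
  ultimately have "\<gamma> = 0" "\<delta> = 0"
    using 1 by auto
  have sub: "subtopology ?X U = top_of_set U"
    using US by (subst nsphere_eq_top_of_set) (simp add: subtopology_subtopology Int_absorb1)
  have fUU: "f \<in> U \<rightarrow> U" using f(2) by auto
  let ?p = "int (Suc m)"
  let ?z = "homologous_rel_set (Suc m) ?X U c"
  have "hom_induced ?p ?X U ?X U f (hom_induced ?p ?X U ?X U f ?z) = \<one>\<^bsub>relative_homology_group ?p ?X U\<^esub>"
  proof (rule hom_induced_square_trivial [OF f(1) fUU])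
    \<comment> \<open>In the positive degree \<open>Suc m\<close> full and reduced homology
      coincide, so degree 0 means the zero map.\<close>
    show "hom_induced ?p ?X {} ?X {} f e = \<one>\<^bsub>homology_group ?p ?X\<^esub>" if "e \<in> carrier (homology_group ?p ?X)" for e
      using Brouwer_degree2 [of e "Suc m" f] that \<open>\<delta> = 0\<close>
      by (simp add: \<delta>_def un_reduced_homology_group del: of_nat_Suc)
    show "hom_induced (?p - 1) (subtopology ?X U) {} (subtopology ?X U) {} f e
        = \<one>\<^bsub>homology_group (?p - 1) (subtopology ?X U)\<^esub>"
      if "e \<in> carrier (reduced_homology_group (?p - 1) (subtopology ?X U))" for e
      using hom_induced_ring_trivial [OF hom US EU \<phi>E fU f(2), of e] that \<open>\<gamma> = 0\<close>
      by (simp add: sub \<gamma>_def)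
    show "?z \<in> carrier (relative_homology_group ?p ?X U)"
      using c by (auto simp: carrier_relative_homology_group simp del: of_nat_Suc)
  qed
  moreover have "hom_induced ?p ?X U ?X U f ?z = homologous_rel_set (Suc m) ?X U (chain_map (Suc m) f c)"
    by (rule hom_induced_chain_map [OF f(1) fUU c])
  moreover have "hom_induced ?p ?X U ?X U f \<dots> = homologous_rel_set (Suc m) ?X U (chain_map (Suc m) f (chain_map (Suc m) f c))"
    by (rule hom_induced_chain_map [OF f(1) fUU singular_relcycle_chain_map [OF c f(1) fUU]])
  ultimately show ?thesis
    by (simp add: homologous_rel_set_eq_relboundary del: of_nat_Suc)
qed


section \<open>From integral to rational homology\<close>

definition rat_frag :: "('b \<Rightarrow>\<^sub>0 int) \<Rightarrow> ('b \<Rightarrow>\<^sub>0 rat)"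
  where "rat_frag c = Poly_Mapping.map of_int c"

lemma lookup_rat_frag [simp]: "Poly_Mapping.lookup (rat_frag c) k = of_int (Poly_Mapping.lookup c k)"
  by (simp add: rat_frag_def Poly_Mapping.map.rep_eq when_def)

lemma keys_rat_frag [simp]: "Poly_Mapping.keys (rat_frag c) = Poly_Mapping.keys c"
  by (auto simp: in_keys_iff)

lemma rat_frag_0 [simp]: "rat_frag 0 = 0"
  by (rule poly_mapping_eqI) simp

lemma rat_frag_diff: "rat_frag (c - d) = rat_frag c - rat_frag d"
  by (rule poly_mapping_eqI) (simp add: lookup_minus)

lemma rat_frag_cmul: "rat_frag (frag_cmul k c) = rat_cmul (of_int k) (rat_frag c)"
  by (rule poly_mapping_eqI) simp

lemma rat_frag_of: "rat_frag (frag_of x) = Poly_Mapping.single x 1"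
  by (rule poly_mapping_eqI) (simp add: lookup_single when_def)

lemma rat_frag_add: "rat_frag (c + d) = rat_frag c + rat_frag d"
  by (rule poly_mapping_eqI) (simp add: lookup_add)

lemma rat_frag_sum: "rat_frag (sum g A) = (\<Sum>i\<in>A. rat_frag (g i))"
  by (induction A rule: infinite_finite_induct) (auto simp: rat_frag_add)

lemma rat_frag_extend: "rat_frag (frag_extend b c) = rat_extend (\<lambda>x. rat_frag (b x)) (rat_frag c)"
  by (simp add: frag_extend_def rat_extend_def rat_frag_sum rat_frag_cmul)

lemma rat_singular_chain_rat_frag [simp]: "rat_singular_chain p X (rat_frag c) \<longleftrightarrow> singular_chain p X c"
  by (simp add: rat_singular_chain_def singular_chain_def)

lemma rat_chain_map_rat_frag: "rat_chain_map p g (rat_frag c) = rat_frag (chain_map p g c)"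
  by (simp add: rat_chain_map_def chain_map_def rat_frag_extend rat_frag_of)

lemma rat_chain_boundary_rat_frag: "rat_chain_boundary p (rat_frag c) = rat_frag (chain_boundary p c)"
  by (simp add: rat_chain_boundary_def chain_boundary_def rat_frag_extend rat_frag_sum rat_frag_cmul rat_frag_of)

lemma rat_relcycle_rat_frag: "rat_relcycle p X S (rat_frag c) \<longleftrightarrow> singular_relcycle p X S c"
  by (simp add: rat_relcycle_def singular_relcycle_def mod_subset_def rat_chain_boundary_rat_frag)

lemma rat_relboundary_rat_frag: "singular_relboundary p X S c \<Longrightarrow> rat_relboundary p X S (rat_frag c)"
  unfolding singular_relboundary_def rat_relboundary_def mod_subset_def
  by (metis (no_types, lifting) case_prodD mem_Collect_eq rat_chain_boundary_rat_frag rat_frag_diff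
      rat_singular_chain_rat_frag)

section \<open>Clearing denominators\<close>

lemma finite_common_denominator:
  fixes g :: "'a \<Rightarrow> rat"
  assumes "finite A"
  shows "\<exists>N::int. N > 0 \<and> (\<forall>x\<in>A. of_int N * g x \<in> \<int>)"
  using assms
proof induction
  case empty
  show ?case by (rule exI [of _ 1]) simp
next
  case (insert x A)
  then obtain N :: int where N: "N > 0" "\<And>x. x \<in> A \<Longrightarrow> of_int N * g x \<in> \<int>" by blast
  obtain p q where q: "quotient_of (g x) = (p, q)" by fastforce
  then have gx: "g x = of_int p / of_int q" and "q > 0"
    using quotient_of_div quotient_of_denom_pos by blast+
  have "of_int (q * N) * g y \<in> \<int>" if "y \<in> insert x A" for y
  proof (cases "y = x")
    case True
    then have "of_int (q * N) * g y = of_int (N * p)"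
      using gx \<open>q > 0\<close> by simp
    then show ?thesis by (metis Ints_of_int)
  next
    case False
    then have "of_int q * (of_int N * g y) \<in> \<int>"
      using that by (intro Ints_mult [OF Ints_of_int N(2)]) simp
    then show ?thesis by (simp add: mult.assoc)
  qed
  then show ?case
    using N(1) \<open>q > 0\<close> by (intro exI [of _ "q * N"]) simp
qed

lemma rat_cmul_eq_rat_frag:
  obtains N c' where "(N::int) > 0" "rat_cmul (of_int N) c = rat_frag c'"
proof -
  obtain N :: int where N: "N > 0" "\<And>x. x \<in> Poly_Mapping.keys c \<Longrightarrow> of_int N * Poly_Mapping.lookup c x \<in> \<int>"
    using finite_common_denominator [of "Poly_Mapping.keys c" "Poly_Mapping.lookup c"] by auto
  \<comment> \<open>The scaled coefficients are already integers; the floor only converts their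
    type.\<close>
  define c' where "c' = Poly_Mapping.map (\<lambda>q. \<lfloor>of_int N * q\<rfloor>) c"
  have "rat_cmul (of_int N) c = rat_frag c'"
  proof (rule poly_mapping_eqI)
    fix k
    show "Poly_Mapping.lookup (rat_cmul (of_int N) c) k = Poly_Mapping.lookup (rat_frag c') k"
      using N(2) [of k] by (cases "k \<in> Poly_Mapping.keys c")
        (auto simp: c'_def Poly_Mapping.map.rep_eq when_def in_keys_iff elim: Ints_cases)
  qed
  with N(1) show ?thesis by (rule that)
qed

section \<open>The collar of a ring neighborhood and the matrix identities\<close>

lemma ring_neighborhood_homeomorphism:
  assumes "ring_neighborhood TYPE('k::euclidean_space) (Suc m) U"
  obtains \<phi> \<psi> where "homeomorphism U (topspace (nsphere m) \<times> {-1..1::real}) \<phi> \<psi>"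
    "U \<subseteq> topspace (nsphere (Suc m))" "\<phi> ` topspace (nsphere m) = topspace (nsphere m) \<times> {0}"
    "topspace (nsphere m) \<subseteq> nsphere (Suc m) interior_of U"
proof -
  obtain \<phi> where \<phi>: "homeomorphic_map (subtopology (nsphere (Suc m)) U)
        (prod_topology (nsphere m) (top_of_set {-1..1::real})) \<phi>"
      "\<phi> ` topspace (nsphere m) = topspace (nsphere m) \<times> {0}"
    and U: "U \<subseteq> topspace (nsphere (Suc m))" "topspace (nsphere m) \<subseteq> nsphere (Suc m) interior_of U"
    using assms by (auto simp: ring_neighborhood_def)
  have "subtopology (nsphere (Suc m)) U = top_of_set U"
    using U(1) by (subst nsphere_eq_top_of_set) (simp add: subtopology_subtopology Int_absorb1)
  moreover have "prod_topology (nsphere m) (top_of_set {-1..1::real}) = top_of_set (topspace (nsphere m) \<times> {-1..1})"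
    by (subst nsphere_eq_top_of_set) (simp add: subtopology_Times)
  ultimately obtain \<psi> where "homeomorphism U (topspace (nsphere m) \<times> {-1..1::real}) \<phi> \<psi>"
    using \<phi>(1) by (auto simp: homeomorphic_map_maps)
  with that \<phi>(2) U show thesis by blast
qed

theorem theorem3p6:
  fixes n :: nat and U :: "(nat \<Rightarrow> real) set" and f :: "(nat \<Rightarrow> real) \<Rightarrow> (nat \<Rightarrow> real)"
    and u v :: "(nat \<Rightarrow> real) rat_chain set" and a b c d :: rat
  defines "H \<equiv> rat_homology n (nsphere n) U"
    and "F \<equiv> rat_hom_induced n (nsphere n) U (nsphere n) U f"
  assumes "n \<ge> 1"
    and "ring_neighborhood TYPE('k::euclidean_space) n U"
    and "continuous_map (nsphere n) (nsphere n) f" and "f ` U \<subseteq> U"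
    and "\<And>x m. \<lbrakk>x \<in> nsphere n closure_of (topspace (nsphere n) - U); m \<ge> 1\<rbrakk> \<Longrightarrow> (f ^^ m) x \<noteq> x"
    and "basis_pair H rat_field u v"
    and "F u = a \<odot>\<^bsub>H\<^esub> u \<oplus>\<^bsub>H\<^esub> c \<odot>\<^bsub>H\<^esub> v"
    and "F v = b \<odot>\<^bsub>H\<^esub> u \<oplus>\<^bsub>H\<^esub> d \<odot>\<^bsub>H\<^esub> v"
  shows "a = - d \<and> b * c = - (a\<^sup>2)"
proof -
  obtain m where n: "n = Suc m"
    using \<open>n \<ge> 1\<close> by (cases n) auto
  obtain \<phi> \<psi> where ring: "homeomorphism U (topspace (nsphere m) \<times> {-1..1::real}) \<phi> \<psi>"
    "U \<subseteq> topspace (nsphere (Suc m))" "\<phi> ` topspace (nsphere m) = topspace (nsphere m) \<times> {0}"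
    "topspace (nsphere m) \<subseteq> nsphere (Suc m) interior_of U"
    using assms(4) ring_neighborhood_homeomorphism unfolding n by metis
  have nofix: "f z \<noteq> z \<and> f (f z) \<noteq> z" if "z \<in> nsphere n closure_of (topspace (nsphere n) - U)" for z
    using assms(7) [OF that, of 1] assms(7) [OF that, of 2] by (simp add: numeral_2_eq_2)
  let ?f = "rat_chain_map n f" and ?cl = "rat_homology_class n (nsphere n) U"
  \<comment> \<open>A multiple of \<open>w\<close> by a positive integer \<open>N\<close> is an
    integral relative cycle, to which the integral result applies; dividing by \<open>N\<close> is
    possible over the rationals.\<close>
  have ff: "?cl (?f (?f w)) = ?cl 0" if w: "rat_relcycle n (nsphere n) U w" for w
  proof -
    obtain N :: int and w' where N: "N > 0" "rat_cmul (of_int N) w = rat_frag w'"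
      by (rule rat_cmul_eq_rat_frag)
    then have "singular_relcycle n (nsphere n) U w'"
      using rat_relcycle_simps(3) [OF w, of "of_int N"] by (simp add: rat_relcycle_rat_frag)
    then have "singular_relboundary n (nsphere n) U (chain_map n f (chain_map n f w'))"
      using chain_map_square_relboundary [OF ring(1-4), of f w'] assms(5,6) nofix by (simp add: n)
    then have "rat_relboundary n (nsphere n) U (?f (?f (rat_cmul (of_int N) w)))"
      unfolding N by (simp add: rat_relboundary_rat_frag rat_chain_map_rat_frag)
    then have "rat_relboundary n (nsphere n) U (rat_cmul (1 / of_int N * of_int N) (?f (?f w)))"
      unfolding rat_chain_map_linear rat_cmul_simps(4) by (rule rat_relboundary_simps(3))
    then show ?thesis
      using N(1) by (simp add: rat_homology_class_eq_iff rat_cmul_simps)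
  qed
  obtain x y where x: "u = ?cl x" "rat_relcycle n (nsphere n) U x"
    and y: "v = ?cl y" "rat_relcycle n (nsphere n) U y"
    using assms(8) by (auto simp: basis_pair_def H_def carrier_rat_homology)
  have Fcl: "F (?cl w) = ?cl (?f w)" for w
    unfolding F_def by (rule rat_hom_induced_class [OF assms(5,6)])
  have lin: "p \<odot>\<^bsub>H\<^esub> ?cl w \<oplus>\<^bsub>H\<^esub> q \<odot>\<^bsub>H\<^esub> ?cl z = ?cl (rat_cmul p w + rat_cmul q z)" for p q w z
    by (simp add: H_def rat_homology_smult rat_homology_add)
  \<comment> \<open>These are the coordinates of the image under \<open>F\<close> of the class with
    coordinates \<open>p\<close> and \<open>q\<close>; linear independence forces them to vanish if
    the image does.\<close>
  have "?cl (rat_cmul (p * a + q * b) x + rat_cmul (p * c + q * d) y) = ?cl 0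
      \<Longrightarrow> p * a + q * b = 0 \<and> p * c + q * d = 0" for p q
    using assms(8) lin by (simp add: basis_pair_def x y rat_field_def H_def zero_rat_homology)
  moreover have "?cl (rat_cmul (p * a + q * b) x + rat_cmul (p * c + q * d) y)
      = ?cl (?f (rat_cmul p x + rat_cmul q y))" for p q
  proof -
    have "?cl (?f (rat_cmul p x + rat_cmul q y)) = p \<odot>\<^bsub>H\<^esub> F u \<oplus>\<^bsub>H\<^esub> q \<odot>\<^bsub>H\<^esub> F v"
      by (simp add: x y Fcl lin rat_chain_map_linear)
    also have "\<dots> = ?cl (rat_cmul p (rat_cmul a x + rat_cmul c y) + rat_cmul q (rat_cmul b x + rat_cmul d y))"
      unfolding assms(9,10) by (simp only: x(1) y(1) lin)
    also have "rat_cmul p (rat_cmul a x + rat_cmul c y) + rat_cmul q (rat_cmul b x + rat_cmul d y)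
        = rat_cmul (p * a + q * b) x + rat_cmul (p * c + q * d) y"
      by (rule poly_mapping_eqI) (simp add: lookup_add algebra_simps)
    finally show ?thesis by (rule sym)
  qed
  moreover have "?cl (?f (rat_cmul a x + rat_cmul c y)) = ?cl (?f (?f x))"
    using assms(9) by (simp add: x(1) y(1) lin flip: Fcl)
  moreover have "?cl (?f (rat_cmul b x + rat_cmul d y)) = ?cl (?f (?f y))"
    using assms(10) by (simp add: x(1) y(1) lin flip: Fcl)
  \<comment> \<open>The columns \<open>(a, c)\<close> and \<open>(b, d)\<close>, taken as
    \<open>(p, q)\<close>, give the four entries of the squared matrix.\<close>
  ultimately have "a * a + c * b = 0" "a * c + c * d = 0" "b * a + d * b = 0" "b * c + d * d = 0"
    using ff [OF x(2)] ff [OF y(2)] by metis+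
  then have "c * (a + d) = 0" "b * (a + d) = 0" "b * c = - (a\<^sup>2)" "(a - d) * (a + d) = 0"
    by (simp_all add: algebra_simps power2_eq_square)
  \<comment> \<open>If \<open>a + d\<close> were nonzero, then \<open>b = c = 0\<close> and
    \<open>a = d\<close>; but \<open>b * c = - (a\<^sup>2)\<close> gives \<open>a = 0\<close>, a
    contradiction.\<close>
  then show ?thesis by auto
qed

end
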